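(* The bijection between surjections and shuffle left combs is compatible with substitution. As a consequence any shuffle operad gives rise to a permutad (by restricting the composition maps from shuffle trees to shuffle left combs). For instance any symmetric operad gives rise to a permutad.
   Context: $\mathbb{K}$ is a commutative ring; $\underline{n}=\{1,\dots,n\}$. $\mathrm{Sur}(\underline{n},\underline{k})$ is the set of surjections $\underline{n}\to\underline{k}$; the unique element of $\mathrm{Sur}(\underline{n},\underline{1})$ is the corolla $c_{n+1}$. Substitution of surjections: for $t\in\mathrm{Sur}(\underline{n},\underline{k})$ and $t_j\in\mathrm{Sur}(\underline{i_j},\underline{m_j})$ with $i_j=\#t^{-1}(j)$, $(t;t_1,\dots,t_k):\underline{n}\to\underline{m_1+\cdots+m_k}$ is the surjection with $(t;t_1,\dots,t_k)(a)=m_1+\cdots+m_{j-1}+t_j(b)$ whenever $t(a)=j$ and $a$ is the $b$-th element of $t^{-1}(j)$ in increasing order. A permutad is an arity-graded module $\mathcal{P}=\{\mathcal{P}_n\}_{n\ge1}$ of $\mathbb{K}$-modules with $\mathcal{P}_1=\mathbb{K}\,\mathrm{id}$ together with linear maps $\Gamma(t;-,\dots,-):\bigotimes_{j=1}^k\mathcal{P}_{\#t^{-1}(j)+1}\to\mathcal{P}_{n+1}$ for all surjections $t:\underline{n}\to\underline{k}$, with $\Gamma(c_{n+1};\mu)=\mu$ and $\Gamma((t;t_1,\dots,t_k);\lambda^1_1,\dots,\lambda^k_{m_k})=\Gamma(t;\Gamma(t_1;\lambda^1_1,\dots,\lambda^1_{m_1}),\dots,\Gamma(t_k;\lambda^k_1,\dots,\lambda^k_{m_k}))$.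 A shuffle tree is a planar rooted tree (each vertex having at least two inputs) whose leaves are labeled bijectively by $\{0,1,\dots,n\}$ such that, when the output edge of each vertex $v$ is labeled by the minimum $\min(v)$ of the labels of the inputs of $v$, the labels of the inputs of every vertex are increasing from left to right. A shuffle tree $\tau'$ with leaves $0,\dots,p$ can be substituted at a vertex with $p+1$ inputs of a shuffle tree $\tau$: replace the vertex by $\tau'$, attaching the leaf $b$ of $\tau'$ to the $(b+1)$-st input of the vertex (from left to right); the result is a shuffle tree. Shuffle trees with substitution define a monad on arity-graded modules: it sends $M$ to the module spanned in arity $n+1$ by shuffle trees with leaves $0,\dots,n$ whose vertices are decorated by elements of $M$ of arity equal to the number of inputs. A shuffle operad is an algebra over this monad; here it is taken with arity-one part $\mathbb{K}\,\mathrm{id}$. A symmetric operad $\{\mathcal{P}(n)\}_{n\ge1}$ (with $\mathcal{P}(1)=\mathbb{K}\,\mathrm{id}$) gives a shuffle operad $\mathcal{P}^{\mathrm{sh}}$ with $\mathcal{P}^{\mathrm{sh}}_n=\mathcal{P}(n)$ (known result of Dotsenko and Khoroshkin). A left comb is a planar tree such that at each vertex all inputs, except possibly the left-most one, are leaves. A shuffle left comb is a shuffle tree whose underlying planar tree is a left comb. The bijection between shuffle left combs with leaves $0,\dots,n$ and $k$ vertices and $\mathrm{Sur}(\underline{n},\underline{k})$: order the vertices downwards (towards the root) from $1$ to $k$; the comb corresponds to the surjection $f$ such that $f^{-1}(j)$ is the set of labels in $\{1,\dots,n\}$ of the leaves attached to the vertex number $j$. *)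

theory Defs
  imports "HOL-Algebra.Module" "HOL-Combinatorics.Permutations" "HOL-Library.FuncSet"
begin

section \<open>Surjections and their substitution\<close>

definition Sur :: "nat \<Rightarrow> nat \<Rightarrow> (nat \<Rightarrow> nat) set" where
  "Sur n k = {t \<in> {1..n} \<rightarrow>\<^sub>E {1..k}. t ` {1..n} = {1..k}}"

definition fibre_card :: "nat \<Rightarrow> (nat \<Rightarrow> nat) \<Rightarrow> nat \<Rightarrow> nat" where
  "fibre_card n t j = card {a \<in> {1..n}. t a = j}"

text \<open>The substitution \<open>(t; t\<^sub>1, \<dots>, t\<^sub>k)\<close>, where \<open>ts j\<close> is a surjection onto \<open>{1..ms j}\<close>.
  The cardinality below is the rank \<open>b\<close> of \<open>a\<close> in its fibre.\<close>

definition subst_sur ::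
  "nat \<Rightarrow> (nat \<Rightarrow> nat) \<Rightarrow> (nat \<Rightarrow> nat) \<Rightarrow> (nat \<Rightarrow> nat \<Rightarrow> nat) \<Rightarrow> nat \<Rightarrow> nat" where
  "subst_sur n t ms ts =
    (\<lambda>a\<in>{1..n}. (\<Sum>i = 1..<t a. ms i) + ts (t a) (card {c \<in> {1..a}. t c = t a}))"


section \<open>Multilinear maps and arity-graded modules\<close>

text \<open>A linear map out of a tensor product is represented by the corresponding multilinear map,
  whose arguments are collected in a list.\<close>

definition multilinear ::
  "'k ring \<Rightarrow> ('k, 'a) module list \<Rightarrow> ('k, 'b) module \<Rightarrow> ('a list \<Rightarrow> 'b) \<Rightarrow> bool" where
  "multilinear K Ms N f \<longleftrightarrow>
    (\<forall>xs \<in> listset (map carrier Ms).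
       f xs \<in> carrier N \<and>
       (\<forall>i < length Ms. \<forall>x \<in> carrier (Ms ! i).
          (\<forall>y \<in> carrier (Ms ! i).
             f (xs[i := x \<oplus>\<^bsub>Ms ! i\<^esub> y]) = f (xs[i := x]) \<oplus>\<^bsub>N\<^esub> f (xs[i := y])) \<and>
          (\<forall>c \<in> carrier K. f (xs[i := c \<odot>\<^bsub>Ms ! i\<^esub> x]) = c \<odot>\<^bsub>N\<^esub> f (xs[i := x]))))"

text \<open>\<open>P n\<close> is only meaningful for \<open>n \<ge> 1\<close>; the last assumption says that \<open>P 1 = K e\<close> is free
  of rank one on \<open>e\<close>. The carriers of the \<open>P n\<close> need not be disjoint, so all structure maps below
  are also given the relevant arities.\<close>

locale arity_graded_module =
  fixes K :: "'k ring" and P :: "nat \<Rightarrow> ('k, 'a) module" and e :: 'a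
  assumes cring: "cring K"
    and module: "n \<ge> 1 \<Longrightarrow> module K (P n)"
    and id_carrier: "e \<in> carrier (P 1)"
    and arity_one: "bij_betw (\<lambda>c. c \<odot>\<^bsub>P 1\<^esub> e) (carrier K) (carrier (P 1))"


section \<open>Permutads\<close>

locale permutad = arity_graded_module K P e
  for K :: "'k ring" and P :: "nat \<Rightarrow> ('k, 'a) module" and e :: 'a +
  fixes \<Gamma> :: "nat \<Rightarrow> (nat \<Rightarrow> nat) \<Rightarrow> 'a list \<Rightarrow> 'a"
  assumes \<Gamma>_multilinear: "\<lbrakk>n \<ge> 1; t \<in> Sur n k\<rbrakk> \<Longrightarrow>
      multilinear K (map (\<lambda>j. P (fibre_card n t j + 1)) [1..<k + 1]) (P (n + 1)) (\<Gamma> n t)"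
    and \<Gamma>_corolla: "\<lbrakk>n \<ge> 1; \<mu> \<in> carrier (P (n + 1))\<rbrakk> \<Longrightarrow> \<Gamma> n (\<lambda>a\<in>{1..n}. 1) [\<mu>] = \<mu>"
    and \<Gamma>_assoc: "\<lbrakk>n \<ge> 1; t \<in> Sur n k;
      \<forall>j \<in> {1..k}. ts j \<in> Sur (fibre_card n t j) (ms j) \<and>
        xss j \<in> listset (map (\<lambda>i. carrier (P (fibre_card (fibre_card n t j) (ts j) i + 1)))
                 [1..<ms j + 1])\<rbrakk> \<Longrightarrow>
      \<Gamma> n (subst_sur n t ms ts) (concat (map xss [1..<k + 1])) =
      \<Gamma> n t (map (\<lambda>j. \<Gamma> (fibre_card n t j) (ts j) (xss j)) [1..<k + 1])"


section \<open>Shuffle trees\<close>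

text \<open>Planar rooted trees with leaves labelled by natural numbers and vertices decorated in
  \<open>'v\<close>; undecorated trees are obtained for \<open>'v = unit\<close>.\<close>

datatype 'v ptree = Leaf nat | Node (decoration: 'v) (inputs: "'v ptree list")

primrec leaves :: "'v ptree \<Rightarrow> nat list" where
  "leaves (Leaf l) = [l]"
| "leaves (Node v ts) = concat (map leaves ts)"

text \<open>A vertex is represented by the subtree above it. Vertices are listed in postorder; in a left
  comb this is the downwards order, from the top vertex to the root vertex.\<close>

primrec vertices :: "'v ptree \<Rightarrow> 'v ptree list" where
  "vertices (Leaf l) = []"
| "vertices (Node v ts) = concat (map vertices ts) @ [Node v ts]"

abbreviation arity :: "'v ptree \<Rightarrow> nat" where
  "arity v \<equiv> length (inputs v)"

primrec edge_label :: "'v ptree \<Rightarrow> nat" where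
  "edge_label (Leaf l) = l"
| "edge_label (Node v ts) = Min (set (map edge_label ts))"

definition shuffle_tree :: "nat \<Rightarrow> 'v ptree \<Rightarrow> bool" where
  "shuffle_tree n T \<longleftrightarrow>
    distinct (leaves T) \<and> set (leaves T) = {0..n} \<and>
    (\<forall>v \<in> set (vertices T). 2 \<le> arity v \<and> sorted_wrt (<) (map edge_label (inputs v)))"

text \<open>\<open>graft S us\<close> attaches \<open>us ! b\<close> to the leaf \<open>b\<close> of \<open>S\<close>. In \<open>subst_tree T\<close> every vertex of \<open>T\<close>
  is replaced by the tree decorating it: this is the multiplication of the monad of trees.\<close>

primrec graft :: "'v ptree \<Rightarrow> 'v ptree list \<Rightarrow> 'v ptree" where
  "graft (Leaf b) us = us ! b"
| "graft (Node v ts) us = Node v (map (\<lambda>t. graft t us) ts)"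

primrec subst_tree :: "'v ptree ptree \<Rightarrow> 'v ptree" where
  "subst_tree (Leaf l) = Leaf l"
| "subst_tree (Node S ts) = graft S (map subst_tree ts)"

definition corolla :: "nat \<Rightarrow> 'v \<Rightarrow> 'v ptree" where
  "corolla n v = Node v (map Leaf [0..<n + 1])"

text \<open>\<open>decorate T xs\<close> has the same underlying tree as \<open>T\<close>, its \<open>j\<close>-th vertex being decorated by the
  \<open>j\<close>-th entry of \<open>xs\<close>.\<close>

primrec decorate :: "'u ptree \<Rightarrow> 'v list \<Rightarrow> 'v ptree"
  and decorate_list :: "'u ptree list \<Rightarrow> 'v list \<Rightarrow> 'v ptree list" where
  "decorate (Leaf l) xs = Leaf l"
| "decorate (Node v ts) xs = Node (last xs) (decorate_list ts (butlast xs))"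
| "decorate_list [] xs = []"
| "decorate_list (t # ts) xs =
    decorate t (take (length (vertices t)) xs) # decorate_list ts (drop (length (vertices t)) xs)"


section \<open>Shuffle operads\<close>

text \<open>An algebra over the monad of shuffle trees: the structure map is given on decorated trees.
  The trivial tree, which has no vertex, yields the identity.\<close>

locale shuffle_operad = arity_graded_module K P e
  for K :: "'k ring" and P :: "nat \<Rightarrow> ('k, 'a) module" and e :: 'a +
  fixes \<gamma> :: "'a ptree \<Rightarrow> 'a"
  assumes \<gamma>_multilinear: "shuffle_tree n (\<tau> :: unit ptree) \<Longrightarrow>
      multilinear K (map (\<lambda>v. P (arity v)) (vertices \<tau>)) (P (n + 1)) (\<lambda>xs. \<gamma> (decorate \<tau> xs))"
    and \<gamma>_trivial: "\<gamma> (Leaf 0) = e"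
    and \<gamma>_corolla: "\<lbrakk>n \<ge> 1; \<mu> \<in> carrier (P (n + 1))\<rbrakk> \<Longrightarrow> \<gamma> (corolla n \<mu>) = \<mu>"
    and \<gamma>_assoc: "\<lbrakk>shuffle_tree n (T :: 'a ptree ptree);
      \<forall>v \<in> set (vertices T). shuffle_tree (arity v - 1) (decoration v) \<and>
        (\<forall>w \<in> set (vertices (decoration v)). decoration w \<in> carrier (P (arity w)))\<rbrakk> \<Longrightarrow>
      \<gamma> (subst_tree T) = \<gamma> (map_ptree \<gamma> T)"


section \<open>Shuffle left combs\<close>

definition left_comb :: "'v ptree \<Rightarrow> bool" where
  "left_comb T \<longleftrightarrow> (\<forall>v \<in> set (vertices T). \<forall>u \<in> set (tl (inputs v)). \<exists>l. u = Leaf l)"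

definition shuffle_left_combs :: "nat \<Rightarrow> nat \<Rightarrow> 'v ptree set" where
  "shuffle_left_combs n k = {T. shuffle_tree n T \<and> left_comb T \<and> length (vertices T) = k}"

definition sur_of_comb :: "nat \<Rightarrow> 'v ptree \<Rightarrow> nat \<Rightarrow> nat" where
  "sur_of_comb n T =
    (\<lambda>a\<in>{1..n}. THE j. j \<in> {1..length (vertices T)} \<and> Leaf a \<in> set (inputs (vertices T ! (j - 1))))"

definition comb_of_sur :: "nat \<Rightarrow> nat \<Rightarrow> (nat \<Rightarrow> nat) \<Rightarrow> unit ptree" where
  "comb_of_sur n k = the_inv_into (shuffle_left_combs n k) (sur_of_comb n)"

text \<open>Restriction of the composition maps of a shuffle operad to left combs; \<open>xs\<close> has one entry
  for each vertex of the comb.\<close>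

definition restrict_to_combs ::
  "('a ptree \<Rightarrow> 'a) \<Rightarrow> nat \<Rightarrow> (nat \<Rightarrow> nat) \<Rightarrow> 'a list \<Rightarrow> 'a" where
  "restrict_to_combs \<gamma> n t xs = \<gamma> (decorate (comb_of_sur n (length xs) t) xs)"


section \<open>Symmetric operads\<close>

text \<open>\<open>act n \<mu> \<sigma>\<close> is the right action of a permutation \<open>\<sigma>\<close> of \<open>{..<n}\<close> on \<open>\<mu> \<in> P n\<close>, and
  \<open>cmp [i\<^sub>1, \<dots>, i\<^sub>n] \<mu> [\<nu>\<^sub>1, \<dots>, \<nu>\<^sub>n]\<close> is the composition of \<open>\<mu> \<in> P n\<close> with \<open>\<nu>\<^sub>j \<in> P i\<^sub>j\<close>. The convention is
  that of the endomorphism operad with \<open>(\<mu> \<cdot> \<sigma>) (x\<^sub>0, \<dots>) = \<mu> (x\<^bsub>\<sigma>\<inverse> 0\<^esub>, x\<^bsub>\<sigma>\<inverse> 1\<^esub>, \<dots>)\<close>. In the two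
  equivariance axioms, \<open>\<beta>\<close> is the block permutation induced by \<open>\<sigma>\<close> on blocks of lengths \<open>is\<close>, and
  the direct sum of the permutations \<open>\<tau>s j\<close>.\<close>

locale symmetric_operad = arity_graded_module K P e
  for K :: "'k ring" and P :: "nat \<Rightarrow> ('k, 'a) module" and e :: 'a +
  fixes act :: "nat \<Rightarrow> 'a \<Rightarrow> (nat \<Rightarrow> nat) \<Rightarrow> 'a"
    and cmp :: "nat list \<Rightarrow> 'a \<Rightarrow> 'a list \<Rightarrow> 'a"
  assumes act_linear: "\<lbrakk>n \<ge> 1; \<sigma> permutes {..<n}\<rbrakk> \<Longrightarrow>
      multilinear K [P n] (P n) (\<lambda>xs. act n (hd xs) \<sigma>)"
    and act_id: "\<lbrakk>n \<ge> 1; \<mu> \<in> carrier (P n)\<rbrakk> \<Longrightarrow> act n \<mu> id = \<mu>"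
    and act_comp: "\<lbrakk>n \<ge> 1; \<mu> \<in> carrier (P n); \<sigma> permutes {..<n}; \<tau> permutes {..<n}\<rbrakk> \<Longrightarrow>
      act n \<mu> (\<sigma> \<circ> \<tau>) = act n (act n \<mu> \<sigma>) \<tau>"
    and comp_multilinear: "\<lbrakk>is \<noteq> []; \<forall>i \<in> set is. i \<ge> 1\<rbrakk> \<Longrightarrow>
      multilinear K (P (length is) # map P is) (P (sum_list is)) (\<lambda>xs. cmp is (hd xs) (tl xs))"
    and comp_id_left: "\<lbrakk>n \<ge> 1; \<mu> \<in> carrier (P n)\<rbrakk> \<Longrightarrow> cmp [n] e [\<mu>] = \<mu>"
    and comp_id_right: "\<lbrakk>n \<ge> 1; \<mu> \<in> carrier (P n)\<rbrakk> \<Longrightarrow> cmp (replicate n 1) \<mu> (replicate n e) = \<mu>"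
    and comp_assoc: "\<lbrakk>iss \<noteq> []; \<forall>is \<in> set iss. is \<noteq> [] \<and> (\<forall>i \<in> set is. i \<ge> 1);
      \<mu> \<in> carrier (P (length iss));
      \<nu>s \<in> listset (map (\<lambda>is. carrier (P (length is))) iss);
      length xss = length iss;
      \<forall>j < length iss. xss ! j \<in> listset (map (\<lambda>i. carrier (P i)) (iss ! j))\<rbrakk> \<Longrightarrow>
      cmp (concat iss) (cmp (map length iss) \<mu> \<nu>s) (concat xss) =
      cmp (map sum_list iss) \<mu> (map (\<lambda>j. cmp (iss ! j) (\<nu>s ! j) (xss ! j)) [0..<length iss])"
    and comp_act_outer: "\<lbrakk>is \<noteq> []; \<forall>i \<in> set is. i \<ge> 1; \<mu> \<in> carrier (P (length is));
      \<nu>s \<in> listset (map (\<lambda>i. carrier (P i)) is); \<sigma> permutes {..<length is};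
      \<beta> permutes {..<sum_list is};
      \<forall>j < length is. \<forall>b < is ! j.
        \<beta> (sum_list (take j is) + b) = sum_list (take (\<sigma> j) (permute_list (inv_into UNIV \<sigma>) is)) + b\<rbrakk> \<Longrightarrow>
      cmp is (act (length is) \<mu> \<sigma>) \<nu>s =
      act (sum_list is) (cmp (permute_list (inv_into UNIV \<sigma>) is) \<mu> (permute_list (inv_into UNIV \<sigma>) \<nu>s)) \<beta>"
    and comp_act_inner: "\<lbrakk>is \<noteq> []; \<forall>i \<in> set is. i \<ge> 1; \<mu> \<in> carrier (P (length is));
      \<nu>s \<in> listset (map (\<lambda>i. carrier (P i)) is);
      \<forall>j < length is. \<tau>s j permutes {..<is ! j};
      \<beta> permutes {..<sum_list is};
      \<forall>j < length is. \<forall>b < is ! j. \<beta> (sum_list (take j is) + b) = sum_list (take j is) + \<tau>s j b\<rbrakk> \<Longrightarrow>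
      cmp is \<mu> (map (\<lambda>j. act (is ! j) (\<nu>s ! j) (\<tau>s j)) [0..<length is]) =
      act (sum_list is) (cmp is \<mu> \<nu>s) \<beta>"

text \<open>The composition maps of the shuffle operad of a symmetric operad: compose along the planar
  tree, then permute the inputs according to the labels of the leaves. With the above convention
  the planar composite \<open>\<mu>\<close> becomes \<open>(x\<^sub>0, \<dots>, x\<^sub>n) \<mapsto> \<mu> (x\<^bsub>l 0\<^esub>, \<dots>, x\<^bsub>l n\<^esub>)\<close>, where \<open>l p\<close> is the label of
  the \<open>p\<close>-th leaf from the left.\<close>

primrec planar_comp :: "(nat list \<Rightarrow> 'a \<Rightarrow> 'a list \<Rightarrow> 'a) \<Rightarrow> 'a \<Rightarrow> 'a ptree \<Rightarrow> 'a" where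
  "planar_comp cmp e (Leaf l) = e"
| "planar_comp cmp e (Node \<mu> ts) =
    cmp (map (\<lambda>t. length (leaves t)) ts) \<mu> (map (planar_comp cmp e) ts)"

definition shuffle_of_symmetric ::
  "(nat \<Rightarrow> 'a \<Rightarrow> (nat \<Rightarrow> nat) \<Rightarrow> 'a) \<Rightarrow> (nat list \<Rightarrow> 'a \<Rightarrow> 'a list \<Rightarrow> 'a) \<Rightarrow> 'a \<Rightarrow> 'a ptree \<Rightarrow> 'a" where
  "shuffle_of_symmetric act cmp e T =
    act (length (leaves T)) (planar_comp cmp e T)
      (inv_into UNIV (\<lambda>p. if p < length (leaves T) then leaves T ! p else p))"

end

theory Submission
  imports Defs
begin

text \<open>A shuffle left comb is a stack of corollas over the leaf \<open>0\<close>, and the \<open>j\<close>-th corolla contributes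
  the \<open>j\<close>-th fibre of the surjection; substituting at a vertex relabels the leaves of the inserted
  stack by that fibre, which is how the fibres of \<open>(t; t\<^sub>1, \<dots>, t\<^sub>k)\<close> arise. For a symmetric operad,
  associativity along planar trees is the operadic one, and the two equivariance axioms move the
  relabellings of the substituted trees and of the vertices to the outside, where they combine into
  the relabelling of the composite tree.\<close>

text \<open>Leaf \<open>0\<close> of an inserted comb receives everything above the vertex that it
  replaces, so an inserted stack becomes a contiguous run of vertices. The offset m_1 + ... +
  m_(j-1) in the substitution of surjections counts the vertices of the runs higher up. Since the
  leaves at each vertex increase, two lists of such leaves agree as soon as their sets do, and most
  comparisons of combs are made on sets. The induction is therefore about planar composites alone.
  It produces some permutation of positions that matches the two leaf words, and only for the whole
  tree are the labels themselves read as a permutation.\<close>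

declare upt_Suc [simp del]

section \<open>Left combs as stacks of corollas\<close>

text \<open>The list runs downwards: its first pair becomes the vertex just below \<open>u\<close>,
  its last pair the root, in agreement with the numbering of the vertices of a comb. The base
  \<open>u\<close> is an arbitrary tree because substitution keeps building on what has already been
  substituted.\<close>

primrec stack :: "'v ptree \<Rightarrow> ('v \<times> nat list) list \<Rightarrow> 'v ptree" where
  "stack u [] = u"
| "stack u (p # ps) = stack (Node (fst p) (u # map Leaf (snd p))) ps"

lemma stack_append: "stack u (ps @ qs) = stack (stack u ps) qs"
  by (induction ps arbitrary: u) auto

lemma leaves_stack: "leaves (stack u ps) = leaves u @ concat (map snd ps)"
proof (induction ps arbitrary: u)
  case (Cons p ps)
  have "concat (map (leaves \<circ> Leaf) xs) = xs" for xs
    by (induction xs) auto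
  with Cons show ?case by simp
qed simp

lemma concat_map_Nil: "(\<And>x. x \<in> set xs \<Longrightarrow> f x = []) \<Longrightarrow> concat (map f xs) = []"
  by (induction xs) auto

text \<open>Right-hand leaves contribute no vertex, so postorder goes through \<open>u\<close> and
  then straight down the spine. The vertex of index \<open>i\<close> sits on the stack of the first
  \<open>i\<close> pairs.\<close>

lemma vertices_stack:
  "vertices (stack u ps) = vertices u @
     map (\<lambda>i. Node (fst (ps ! i)) (stack u (take i ps) # map Leaf (snd (ps ! i)))) [0..<length ps]"
proof (induction ps rule: rev_induct)
  case (snoc p ps)
  then show ?case
    by (auto simp: stack_append nth_append comp_def concat_map_Nil upt_Suc)
qed simp

lemma length_vertices_stack: "length (vertices (stack u ps)) = length (vertices u) + length ps"
  by (simp add: vertices_stack)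

text \<open>The minimum is handed down the spine unchanged, so every left-most input of a stack
  carries the label of the base.\<close>

lemma edge_label_stack:
  assumes "\<forall>p \<in> set ps. \<forall>l \<in> set (snd p). edge_label u \<le> l"
  shows "edge_label (stack u ps) = edge_label u"
  using assms
proof (induction ps rule: rev_induct)
  case (snoc p ps)
  then have "edge_label (stack u ps) = edge_label u" by simp
  moreover have "Min (insert (edge_label u) (set (snd p))) = edge_label u"
    using snoc.prems by (intro Min_eqI) auto
  ultimately show ?case by (simp add: stack_append image_image)
qed simp

lemma left_comb_stack: "left_comb u \<Longrightarrow> left_comb (stack u ps)"
  by (auto simp: left_comb_def vertices_stack)

text \<open>Peel off the root: its left-most input is again a left comb and its remaining inputs
  form the last corolla. Nonempty inputs have to be assumed, because \<open>left_comb\<close> admits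
  a vertex without inputs and a stack over a leaf has none.\<close>

lemma left_comb_imp_stack:
  assumes "left_comb T" "\<And>v. v \<in> set (vertices T) \<Longrightarrow> inputs v \<noteq> []"
  obtains l ps where "T = stack (Leaf l) ps"
  using assms
proof (induction T arbitrary: thesis)
  case (Leaf l)
  from Leaf(1)[of l "[]"] show ?case by simp
next
  case (Node v ts)
  from Node.prems(3)[of "Node v ts"] obtain u us where ts: "ts = u # us"
    by (cases ts) auto
  have "left_comb u" "\<And>v. v \<in> set (vertices u) \<Longrightarrow> inputs v \<noteq> []"
    using Node.prems(2,3) by (auto simp: left_comb_def ts)
  then obtain l ps where u: "u = stack (Leaf l) ps"
    using Node.IH[of u] by (auto simp: ts)
  have "\<forall>w \<in> set us. \<exists>l. w = Leaf l"
    using Node.prems(2) by (auto simp: left_comb_def ts)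
  then have "\<exists>ls. us = map Leaf ls"
    by (simp add: ex_map_conv)
  then obtain ls where "us = map Leaf ls" ..
  then have "Node v ts = stack (Leaf l) (ps @ [(v, ls)])"
    by (simp add: stack_append u ts)
  then show ?case by (rule Node.prems(1))
qed

lemma decorate_list_Leaf: "decorate_list (map Leaf ls) xs = map Leaf ls"
  by (induction ls arbitrary: xs) auto

lemma decorate_stack:
  "length ys = length ps \<Longrightarrow> decorate (stack (Leaf l) ps) ys = stack (Leaf l) (zip ys (map snd ps))"
proof (induction ps arbitrary: ys rule: rev_induct)
  case (snoc p ps)
  then obtain y ys' where "ys = ys' @ [y]" "length ys' = length ps"
    by (metis length_append_singleton length_Suc_conv_rev)
  with snoc.IH[of ys'] show ?case
    by (simp add: stack_append decorate_list_Leaf length_vertices_stack)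
qed simp

lemma map_ptree_stack: "map_ptree f (stack u ps) = stack (map_ptree f u) (map (apfst f) ps)"
  by (induction ps arbitrary: u) (auto simp: comp_def)

text \<open>Only the base of a stack may receive a tree with vertices. The right-hand leaves receive
  leaves, so grafting there is a mere relabelling and the result is a stack again.\<close>

lemma graft_stack:
  assumes "\<forall>p \<in> set ps. \<forall>l \<in> set (snd p). us ! l = Leaf (g l)"
  shows "graft (stack u ps) us = stack (graft u us) (map (apsnd (map g)) ps)"
  using assms
proof (induction ps arbitrary: u)
  case (Cons p ps)
  then have "map (\<lambda>l. us ! l) (snd p) = map (\<lambda>l. Leaf (g l)) (snd p)"
    by simp
  with Cons show ?case by (simp add: comp_def cong: map_cong)
qed simp

text \<open>At a vertex with right-hand leaves \<open>A\<close>, input number 0 is the spine and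
  input number \<open>l\<close> is the leaf at index \<open>l - 1\<close> of \<open>A\<close>. Hence
  the base of the inserted stack is replaced by the tree substituted so far, and its other leaves
  are relabelled through \<open>A\<close>.\<close>

lemma subst_tree_stack:
  assumes "\<forall>(q, A) \<in> set ps. \<forall>p \<in> set q. \<forall>l \<in> set (snd p). l \<in> {1..length A}"
  shows "subst_tree (stack u (map (apfst (stack (Leaf 0))) ps)) =
    stack (subst_tree u) (concat (map (\<lambda>(q, A). map (apsnd (map (\<lambda>l. A ! (l - 1)))) q) ps))"
  using assms
proof (induction ps arbitrary: u)
  case (Cons p ps)
  obtain q A where p: "p = (q, A)" by fastforce
  have "graft (stack (Leaf 0) q) (subst_tree u # map Leaf A) =
    stack (subst_tree u) (map (apsnd (map (\<lambda>l. A ! (l - 1)))) q)"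
    by (subst graft_stack[where g = "\<lambda>l. A ! (l - 1)"])
      (use Cons.prems in \<open>force simp: p nth_Cons'\<close>)+
  moreover have "map (subst_tree \<circ> Leaf) A = map Leaf A" by (simp add: comp_def)
  ultimately show ?case
    using Cons by (simp add: p stack_append comp_def)
qed simp


section \<open>The shuffle left comb of a surjection\<close>

text \<open>An increasing list serves two purposes: it gives the leaves of a corolla from left to
  right, and the element of rank \<open>l\<close> stands at index \<open>l - 1\<close>.\<close>

definition fibre :: "nat \<Rightarrow> (nat \<Rightarrow> nat) \<Rightarrow> nat \<Rightarrow> nat list" where
  "fibre n t j = filter (\<lambda>a. t a = j) [1..<n + 1]"

lemma set_fibre: "set (fibre n t j) = {a \<in> {1..n}. t a = j}"
  by (auto simp: fibre_def)

lemma length_fibre: "length (fibre n t j) = fibre_card n t j"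
proof -
  have "distinct (fibre n t j)" by (simp add: fibre_def)
  then show ?thesis by (metis distinct_card set_fibre fibre_card_def)
qed

lemma sorted_fibre: "sorted_wrt (<) (fibre n t j)"
  unfolding fibre_def by (intro sorted_wrt_filter) simp

lemma rank_sorted:
  fixes xs :: "nat list"
  assumes "sorted_wrt (<) xs" "p < length xs"
  shows "card {c \<in> set xs. c \<le> xs ! p} = Suc p"
proof -
  have less: "xs ! i < xs ! j \<longleftrightarrow> i < j" if "i < length xs" "j < length xs" for i j
    using sorted_wrt_nth_less[OF assms(1), of i j] sorted_wrt_nth_less[OF assms(1), of j i] that
    by (cases i j rule: linorder_cases) auto
  have "{c \<in> set xs. c \<le> xs ! p} = (!) xs ` {..p}"
  proof (intro equalityI subsetI)
    fix c assume "c \<in> {c \<in> set xs. c \<le> xs ! p}"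
    then obtain i where "i < length xs" "c = xs ! i" "\<not> xs ! p < xs ! i"
      by (auto simp: in_set_conv_nth)
    then show "c \<in> (!) xs ` {..p}" using less[of p i] assms(2) by auto
  next
    fix c assume "c \<in> (!) xs ` {..p}"
    then obtain i where "i \<le> p" "c = xs ! i" by auto
    then show "c \<in> {c \<in> set xs. c \<le> xs ! p}"
      using less[of p i] assms(2) by auto
  qed
  moreover have "inj_on ((!) xs) {..p}"
    using assms by (auto intro!: inj_on_nth simp: strict_sorted_iff)
  ultimately show ?thesis by (simp add: card_image)
qed

text \<open>Translates the cardinality that \<open>subst_sur\<close> uses for the rank into a
  position in the fibre.\<close>

lemma rank_fibre:
  assumes "l \<in> {1..fibre_card n t j}" and "a = fibre n t j ! (l - 1)"
  shows "card {c \<in> {1..a}. t c = t a} = l"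
proof -
  have "a \<in> set (fibre n t j)" using assms by (auto simp: length_fibre)
  then have "{c \<in> {1..a}. t c = t a} = {c \<in> set (fibre n t j). c \<le> a}"
    by (auto simp: set_fibre)
  also have "card \<dots> = l"
    using rank_sorted[OF sorted_fibre, of "l - 1" n t j] assms by (auto simp: length_fibre)
  finally show ?thesis .
qed

lemma fibre_rank:
  assumes "a \<in> {1..n}" and "t a = j"
  obtains l where "l \<in> {1..fibre_card n t j}" "a = fibre n t j ! (l - 1)"
    "card {c \<in> {1..a}. t c = t a} = l"
proof -
  have "a \<in> set (fibre n t j)" using assms by (auto simp: set_fibre)
  then obtain p where "p < fibre_card n t j" "a = fibre n t j ! p"
    by (auto simp: in_set_conv_nth length_fibre)
  then have "Suc p \<in> {1..fibre_card n t j}" "a = fibre n t j ! (Suc p - 1)"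
    by simp_all
  from that[OF this rank_fibre[OF this]] show thesis .
qed

lemma Sur_range: "\<lbrakk>t \<in> Sur n k; a \<in> {1..n}\<rbrakk> \<Longrightarrow> t a \<in> {1..k}"
  unfolding Sur_def by (blast dest: PiE_mem)

lemma fibre_card_pos:
  assumes "t \<in> Sur n k" "j \<in> {1..k}"
  shows "fibre_card n t j \<ge> 1"
proof -
  have "j \<in> t ` {1..n}" using assms unfolding Sur_def by blast
  then obtain a where "a \<in> set (fibre n t j)" by (auto simp: set_fibre)
  then have "length (fibre n t j) > 0" by (rule length_pos_if_in_set)
  then show ?thesis by (simp add: length_fibre)
qed

text \<open>The number of vertices of the comb is read off the list of decorations, as in
  \<open>restrict_to_combs\<close>.\<close>

definition comb :: "nat \<Rightarrow> (nat \<Rightarrow> nat) \<Rightarrow> 'v list \<Rightarrow> 'v ptree" where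
  "comb n t xs = stack (Leaf 0) (zip xs (map (fibre n t) [1..<length xs + 1]))"

lemma length_vertices_comb: "length (vertices (comb n t xs)) = length xs"
  by (simp add: comb_def length_vertices_stack)

text \<open>The last alternative guarantees that the left-most input is never a leaf labelled in
  \<open>{1..n}\<close>. This is what makes the description in \<open>sur_of_comb\<close> single out
  one vertex.\<close>

lemma vertex_comb:
  assumes "j \<in> {1..length xs}"
  obtains u where "vertices (comb n t xs) ! (j - 1) = Node (xs ! (j - 1)) (u # map Leaf (fibre n t j))"
    "edge_label u = 0" "u = Leaf 0 \<or> (\<forall>l. u \<noteq> Leaf l)"
proof -
  define ps where "ps = zip xs (map (fibre n t) [1..<length xs + 1])"
  define u where "u = stack (Leaf 0) (take (j - 1) ps)"
  have nth: "ps ! (j - 1) = (xs ! (j - 1), fibre n t j)"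
    using assms by (auto simp: ps_def)
  have "vertices (comb n t xs) ! (j - 1) = Node (xs ! (j - 1)) (u # map Leaf (fibre n t j))"
  proof -
    have "comb n t xs = stack (Leaf 0) ps" "length ps = length xs"
      by (simp_all add: comb_def ps_def)
    with assms nth show ?thesis by (auto simp: vertices_stack u_def)
  qed
  moreover have "edge_label u = 0"
    unfolding u_def by (subst edge_label_stack) auto
  moreover have "u = Leaf 0 \<or> (\<forall>l. u \<noteq> Leaf l)"
    unfolding u_def by (cases "take (j - 1) ps" rule: rev_cases) (auto simp: stack_append)
  ultimately show thesis by (rule that)
qed

lemma vertex_combE:
  assumes "v \<in> set (vertices (comb n t xs))"
  obtains j u where "j \<in> {1..length xs}" "v = Node (xs ! (j - 1)) (u # map Leaf (fibre n t j))"
    "edge_label u = 0"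
proof -
  from assms obtain i where "i < length xs" "v = vertices (comb n t xs) ! i"
    by (auto simp: in_set_conv_nth length_vertices_comb)
  then have "Suc i \<in> {1..length xs}" "v = vertices (comb n t xs) ! (Suc i - 1)" by auto
  then obtain u where "v = Node (xs ! (Suc i - 1)) (u # map Leaf (fibre n t (Suc i)))" "edge_label u = 0"
    by (metis vertex_comb[of "Suc i" xs n t])
  with \<open>Suc i \<in> {1..length xs}\<close> show thesis by (rule that)
qed

lemma map_arity_vertices_comb:
  "map (\<lambda>v. f (arity v)) (vertices (comb n t xs)) = map (\<lambda>j. f (fibre_card n t j + 1)) [1..<length xs + 1]"
proof (rule nth_equalityI)
  fix i assume "i < length (map (\<lambda>v. f (arity v)) (vertices (comb n t xs)))"
  then have i: "i < length xs" by (simp add: length_vertices_comb)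
  then have "Suc i \<in> {1..length xs}" by simp
  then obtain u where
    "vertices (comb n t xs) ! (Suc i - 1) = Node (xs ! (Suc i - 1)) (u # map Leaf (fibre n t (Suc i)))"
    by (rule vertex_comb)
  with i show "map (\<lambda>v. f (arity v)) (vertices (comb n t xs)) ! i =
    map (\<lambda>j. f (fibre_card n t j + 1)) [1..<length xs + 1] ! i"
    by (simp add: length_vertices_comb length_fibre)
qed (simp add: length_vertices_comb)

lemma decorate_comb: "length ys = length xs \<Longrightarrow> decorate (comb n t xs) ys = comb n t ys"
  by (simp add: comb_def decorate_stack)

lemma map_ptree_comb: "map_ptree f (comb n t xs) = comb n t (map f xs)"
  unfolding comb_def map_ptree_stack
  by (simp add: apfst_def map_prod_def zip_map1 split_def)

lemma leaves_comb: "leaves (comb n t xs) = 0 # concat (map (fibre n t) [1..<length xs + 1])"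
  by (simp add: comb_def leaves_stack)

text \<open>The fibres partition \<open>{1..n}\<close>, which accounts for the leaves. Surjectivity
  makes each fibre nonempty, so together with the spine a vertex has at least two inputs; the spine
  has label \<open>0\<close>, below all labels of the fibre.\<close>

lemma comb_in_shuffle_left_combs:
  assumes t: "t \<in> Sur n (length xs)"
  shows "comb n t xs \<in> shuffle_left_combs n (length xs)"
proof -
  have "distinct (leaves (comb n t xs))"
  proof -
    have "distinct (concat (map (fibre n t) js))" if "distinct js" for js
      using that
      by (induction js) (auto simp: set_fibre, auto simp: fibre_def)
    then show ?thesis by (simp add: leaves_comb set_fibre)
  qed
  moreover have "set (leaves (comb n t xs)) = {0..n}"
  proof -
    have "(\<Union>j\<in>{1..length xs}. set (fibre n t j)) = {1..n}"
      unfolding set_fibre using Sur_range[OF t] by blast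
    moreover have "insert 0 {1..n} = {0..n}" by auto
    ultimately show ?thesis by (simp add: leaves_comb atLeastLessThanSuc_atLeastAtMost)
  qed
  moreover have "2 \<le> arity v \<and> sorted_wrt (<) (map edge_label (inputs v))"
    if "v \<in> set (vertices (comb n t xs))" for v
    using that
  proof (rule vertex_combE)
    fix j u assume j: "j \<in> {1..length xs}"
      and v: "v = Node (xs ! (j - 1)) (u # map Leaf (fibre n t j))" "edge_label u = 0"
    show ?thesis
      using fibre_card_pos[OF t j] sorted_fibre[of n t j]
      by (auto simp: v length_fibre comp_def set_fibre)
  qed
  ultimately have "shuffle_tree n (comb n t xs)" by (simp add: shuffle_tree_def)
  moreover have "left_comb (comb n t xs)"
    unfolding comb_def by (rule left_comb_stack) (simp add: left_comb_def)
  ultimately show ?thesis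
    by (simp add: shuffle_left_combs_def length_vertices_comb)
qed

lemma sur_of_comb_comb:
  assumes t: "t \<in> Sur n (length xs)"
  shows "sur_of_comb n (comb n t xs) = t"
proof
  fix a
  show "sur_of_comb n (comb n t xs) a = t a"
  proof (cases "a \<in> {1..n}")
    case True
    have "j \<in> {1..length xs} \<and> Leaf a \<in> set (inputs (vertices (comb n t xs) ! (j - 1))) \<longleftrightarrow> j = t a" for j
    proof (cases "j \<in> {1..length xs}")
      case j: True
      then obtain u where
        "vertices (comb n t xs) ! (j - 1) = Node (xs ! (j - 1)) (u # map Leaf (fibre n t j))"
        "u = Leaf 0 \<or> (\<forall>l. u \<noteq> Leaf l)" by (rule vertex_comb)
      with True j show ?thesis by (auto simp: set_fibre)
    qed (use Sur_range[OF t True] in auto)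
    with True show ?thesis
      by (simp add: sur_of_comb_def length_vertices_comb)
  next
    case False
    moreover from t False have "t a = undefined"
      unfolding Sur_def by (blast dest: PiE_arb)
    ultimately show ?thesis by (simp only: sur_of_comb_def restrict_apply if_False)
  qed
qed

text \<open>The right-hand leaves of the vertices are pairwise disjoint, cover \<open>{1..n}\<close>
  and are nonempty, so they are the fibres of a surjection; being increasing, they equal these
  fibres as lists too.\<close>

lemma shuffle_left_comb_eq_comb:
  assumes T: "T \<in> shuffle_left_combs n k"
  obtains t xs where "t \<in> Sur n k" "length xs = k" "T = comb n t xs"
proof -
  have sh: "shuffle_tree n T" and lc: "left_comb T" and k: "length (vertices T) = k"
    using T by (auto simp: shuffle_left_combs_def)
  have node: "2 \<le> arity v" "sorted_wrt (<) (map edge_label (inputs v))" if "v \<in> set (vertices T)" for v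
    using sh that by (auto simp: shuffle_tree_def)
  have "inputs v \<noteq> []" if "v \<in> set (vertices T)" for v
    using node(1)[OF that] by auto
  with lc obtain l ps where T_eq: "T = stack (Leaf l) ps"
    by (rule left_comb_imp_stack)
  have len: "length ps = k" using k by (simp add: T_eq length_vertices_stack)
  define A where "A j = snd (ps ! (j - 1))" for j
  have vertex: "Node (fst (ps ! i)) (stack (Leaf l) (take i ps) # map Leaf (snd (ps ! i))) \<in> set (vertices T)"
    if "i < k" for i using that by (auto simp: T_eq vertices_stack len)
  \<comment> \<open>Downwards along the spine: if all earlier leaves exceed \<open>l\<close>, the
    spine has label \<open>l\<close>, and the increasing inputs of the next vertex force its leaves
    above \<open>l\<close> as well.\<close>
  have lower: "\<forall>p \<in> set (take i ps). \<forall>a \<in> set (snd p). l < a" if "i \<le> k" for i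
    using that
  proof (induction i)
    case (Suc i)
    then have IH: "\<forall>p \<in> set (take i ps). \<forall>a \<in> set (snd p). l < a" and i: "i < k" by auto
    from IH have "edge_label (stack (Leaf l) (take i ps)) = l"
      by (simp add: edge_label_stack less_imp_le)
    then have "\<forall>a \<in> set (snd (ps ! i)). l < a"
      using node(2)[OF vertex[OF i]] by simp
    with IH i show ?case by (simp add: take_Suc_conv_app_nth len)
  qed simp
  have lv: "leaves T = l # concat (map snd ps)" by (simp add: T_eq leaves_stack)
  \<comment> \<open>The label \<open>0\<close> occurs somewhere, and at a right-hand leaf it would
    have to exceed \<open>l\<close>.\<close>
  have "l = 0"
  proof (rule ccontr)
    assume "l \<noteq> 0"
    moreover have "0 \<in> set (leaves T)" using sh by (simp add: shuffle_tree_def)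
    ultimately show False using lower[of k] by (auto simp: lv len)
  qed
  have A_ne: "A j \<noteq> []" and A_sorted: "sorted_wrt (<) (A j)" if "j \<in> {1..k}" for j
  proof -
    from that have "j - 1 < k" by auto
    from node[OF vertex[OF this]] show "A j \<noteq> []" "sorted_wrt (<) (A j)"
      by (auto simp: A_def comp_def)
  qed
  have ps: "ps = zip (map fst ps) (map A [1..<k + 1])"
    by (rule nth_equalityI) (auto simp: len A_def)
  have snd_ps: "map snd ps = map A [1..<k + 1]"
    by (subst ps) (simp add: len)
  have dist: "distinct (concat (map A [1..<k + 1]))" and "0 \<notin> set (concat (map A [1..<k + 1]))"
    and "insert 0 (set (concat (map A [1..<k + 1]))) = {0..n}"
    using sh by (auto simp: shuffle_tree_def lv snd_ps \<open>l = 0\<close> simp del: upt_Suc set_concat)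
  then have "set (concat (map A [1..<k + 1])) = {0..n} - {0}" by blast
  also have "{0..n} - {0} = {1..n}" by auto
  finally have union: "(\<Union>j\<in>{1..k}. set (A j)) = {1..n}"
    by (simp add: atLeastLessThanSuc_atLeastAtMost)
  have disj: "i = j" if "i \<in> {1..k}" "j \<in> {1..k}" "a \<in> set (A i)" "a \<in> set (A j)" for a i j
  proof (rule ccontr)
    assume "i \<noteq> j"
    have "set (A i) \<inter> set (A j) = {}" if "distinct (concat (map A js))" "i \<in> set js" "j \<in> set js" for js
      using that \<open>i \<noteq> j\<close> by (induction js) auto
    from this[OF dist] that show False by auto
  qed
  define t where "t = (\<lambda>a\<in>{1..n}. THE j. j \<in> {1..k} \<and> a \<in> set (A j))"
  have t_eq: "t a = j" if "j \<in> {1..k}" "a \<in> set (A j)" for a j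
  proof -
    have "a \<in> {1..n}" using union that by blast
    then show ?thesis unfolding t_def using that disj by auto
  qed
  have t_iff: "a \<in> set (A j) \<longleftrightarrow> a \<in> {1..n} \<and> t a = j" if "j \<in> {1..k}" for a j
    using that t_eq union by blast
  have "t \<in> Sur n k"
  proof -
    have "t ` {1..n} = {1..k}"
    proof (intro equalityI subsetI)
      fix j assume j: "j \<in> {1..k}"
      from A_ne[OF j] obtain a where "a \<in> set (A j)" by fastforce
      with t_iff[OF j, of a] show "j \<in> t ` {1..n}" by auto
    qed (use union t_eq in blast)
    moreover have "t \<in> extensional {1..n}" by (simp add: t_def)
    ultimately show ?thesis by (auto simp: Sur_def PiE_def)
  qed
  moreover have "fibre n t j = A j" if "j \<in> {1..k}" for j
    using that by (intro strict_sorted_equal sorted_fibre A_sorted) (auto simp: set_fibre t_iff)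
  then have fibres: "map (fibre n t) [1..<k + 1] = map A [1..<k + 1]"
    by (intro map_cong) auto
  have "T = comb n t (map fst ps)"
    by (simp only: comb_def T_eq \<open>l = 0\<close> length_map len fibres flip: ps)
  ultimately show thesis using len by (intro that) auto
qed

lemma unit_list_eq: "length xs = length ys \<Longrightarrow> xs = (ys :: unit list)"
  by (simp add: list_eq_iff_nth_eq)

lemma bij_betw_sur_of_comb:
  "bij_betw (sur_of_comb n) (shuffle_left_combs n k :: unit ptree set) (Sur n k)"
proof (rule bij_betw_byWitness[where f' = "\<lambda>t. comb n t (replicate k ())"])
  have *: "T = comb n (sur_of_comb n T) (replicate k ()) \<and> sur_of_comb n T \<in> Sur n k"
    if "T \<in> shuffle_left_combs n k" for T :: "unit ptree"
  proof -
    from that obtain t xs where "t \<in> Sur n k" "length xs = k" "T = comb n t xs"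
      by (rule shuffle_left_comb_eq_comb)
    moreover have "xs = replicate k ()" using \<open>length xs = k\<close> by (intro unit_list_eq) simp
    ultimately show ?thesis using sur_of_comb_comb[of t n xs] by simp
  qed
  then show "\<forall>T\<in>shuffle_left_combs n k. comb n (sur_of_comb n T) (replicate k ()) = (T :: unit ptree)"
    and "sur_of_comb n ` (shuffle_left_combs n k :: unit ptree set) \<subseteq> Sur n k" by auto
  show "\<forall>t\<in>Sur n k. sur_of_comb n (comb n t (replicate k ())) = t"
    by (auto intro: sur_of_comb_comb)
  show "(\<lambda>t. comb n t (replicate k ())) ` Sur n k \<subseteq> shuffle_left_combs n k"
    using comb_in_shuffle_left_combs[of _ n "replicate k ()"] by auto
qed

lemma comb_of_sur_eq:
  assumes "t \<in> Sur n k"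
  shows "comb_of_sur n k t = comb n t (replicate k ())"
  unfolding comb_of_sur_def
proof (rule the_inv_into_f_eq)
  show "inj_on (sur_of_comb n) (shuffle_left_combs n k :: unit ptree set)"
    using bij_betw_sur_of_comb by (rule bij_betw_imp_inj_on)
qed (use assms sur_of_comb_comb[of t n "replicate k ()"]
    comb_in_shuffle_left_combs[of t n "replicate k ()"] in auto)


section \<open>Substitution of surjections and of combs\<close>

text \<open>The numbering of the target of a substituted surjection, block after block. It serves to
  match lists of fibres and, after applying \<open>set\<close>, to prove surjectivity.\<close>

lemma upt_blocks:
  "map f [1..<(\<Sum>j = 1..k. m j) + 1] =
   concat (map (\<lambda>j. map (\<lambda>i. f ((\<Sum>i = 1..<j. m i) + i)) [1..<m j + 1]) [1..<k + 1])"
proof (induction k)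
  case (Suc k)
  define M where "M = (\<Sum>j = 1..k. m j)"
  have "[1..<M + m (Suc k) + 1] = [1..<M + 1] @ [M + 1..<M + m (Suc k) + 1]"
    using upt_add_eq_append[of 1 "M + 1" "m (Suc k)"] by (simp add: ac_simps)
  also have "[M + 1..<M + m (Suc k) + 1] = map (\<lambda>i. M + i) [1..<m (Suc k) + 1]"
    by (rule nth_equalityI) auto
  finally show ?case
    using Suc by (simp add: M_def atLeastLessThanSuc_atLeastAtMost comp_def add.commute
        upt_Suc_append[of _ "Suc k"])
qed simp

text \<open>If \<open>j < j'\<close>, the left side does not exceed the total of the blocks before
  \<open>j'\<close>, while the right side does because \<open>b'\<close> is at least 1.\<close>

lemma block_unique:
  fixes m :: "nat \<Rightarrow> nat"
  assumes "(\<Sum>i = 1..<j. m i) + b = (\<Sum>i = 1..<j'. m i) + b'"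
    and "b \<in> {1..m j}" "b' \<in> {1..m j'}" "1 \<le> j" "1 \<le> j'"
  shows "j = j' \<and> b = b'"
proof -
  have *: False if "(\<Sum>i = 1..<j. m i) + b = (\<Sum>i = 1..<j'. m i) + b'"
    "b \<in> {1..m j}" "b' \<in> {1..m j'}" "1 \<le> j" "j < j'" for j j' b b'
  proof -
    have "(\<Sum>i = 1..<j. m i) + m j = (\<Sum>i = 1..<Suc j. m i)" using that by simp
    also have "\<dots> \<le> (\<Sum>i = 1..<j'. m i)" using that by (intro sum_mono2) auto
    finally show False using that by auto
  qed
  from *[of j b j' b'] *[of j' b' j b] assms show ?thesis
    by (cases j j' rule: linorder_cases) auto
qed

lemma length_concat_blocks:
  assumes "\<And>j. j \<in> {1..k} \<Longrightarrow> length (xss j) = ms j"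
  shows "length (concat (map xss [1..<k + 1])) = (\<Sum>j = 1..k. ms j)"
proof -
  have "length (concat (map xss [1..<k + 1])) = (\<Sum>j\<leftarrow>[1..<k + 1]. ms j)"
    unfolding length_concat map_map using assms by (intro arg_cong[where f = sum_list] map_cong) auto
  also have "\<dots> = (\<Sum>j = 1..k. ms j)"
    by (simp add: interv_sum_list_conv_sum_set_nat atLeastLessThanSuc_atLeastAtMost)
  finally show ?thesis .
qed

locale surjection_substitution =
  fixes n k t ms and ts :: "nat \<Rightarrow> nat \<Rightarrow> nat"
  assumes t: "t \<in> Sur n k"
    and ts: "j \<in> {1..k} \<Longrightarrow> ts j \<in> Sur (fibre_card n t j) (ms j)"
begin

text \<open>Elements of \<open>{1..n}\<close> are parametrised by their fibre \<open>j\<close> and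
  their rank \<open>l\<close> in it; in these coordinates the cardinality in
  \<open>subst_sur\<close> is just \<open>l\<close>.\<close>

lemma subst_sur_nth_fibre:
  assumes "j \<in> {1..k}" "l \<in> {1..fibre_card n t j}" "a = fibre n t j ! (l - 1)"
  shows "subst_sur n t ms ts a = (\<Sum>i = 1..<j. ms i) + ts j l" "a \<in> {1..n}" "t a = j"
    and "ts j l \<in> {1..ms j}"
proof -
  have "a \<in> set (fibre n t j)" using assms by (auto simp: length_fibre)
  then show *: "a \<in> {1..n}" "t a = j" by (auto simp: set_fibre)
  show "ts j l \<in> {1..ms j}" using Sur_range[OF ts] assms by blast
  show "subst_sur n t ms ts a = (\<Sum>i = 1..<j. ms i) + ts j l"
    using * rank_fibre[OF assms(2,3)] by (simp add: subst_sur_def)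
qed

text \<open>The right-hand side is the relabelling that \<open>subst_tree_stack\<close> performs.
  Both lists increase, so comparing sets is enough, and \<open>block_unique\<close> recovers the
  fibre and the inner value from the value of the substitution.\<close>

lemma fibre_subst_sur:
  assumes j: "j \<in> {1..k}" and i: "i \<in> {1..ms j}"
  shows "fibre n (subst_sur n t ms ts) ((\<Sum>i = 1..<j. ms i) + i) =
    map (\<lambda>l. fibre n t j ! (l - 1)) (fibre (fibre_card n t j) (ts j) i)" (is "?L = map ?g ?R")
proof (rule strict_sorted_equal)
  have "sorted_wrt (\<lambda>x y. ?g x < ?g y) ?R"
  proof (rule sorted_wrt_mono_rel[OF _ sorted_fibre])
    fix x y assume "x \<in> set ?R" "y \<in> set ?R" "x < y"
    then show "?g x < ?g y"
      by (intro sorted_wrt_nth_less[OF sorted_fibre]) (auto simp: set_fibre length_fibre)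
  qed
  then show "sorted_wrt (<) (map ?g ?R)" by (simp add: sorted_wrt_map)
  show "set ?L = set (map ?g ?R)"
  proof (intro equalityI subsetI)
    fix a assume "a \<in> set (map ?g ?R)"
    then obtain l where l: "l \<in> {1..fibre_card n t j}" "ts j l = i" "a = ?g l"
      by (auto simp: set_fibre)
    then show "a \<in> set ?L" using subst_sur_nth_fibre(1,2)[OF j l(1,3)] by (auto simp: set_fibre)
  next
    fix a assume "a \<in> set ?L"
    then have a: "a \<in> {1..n}" "subst_sur n t ms ts a = (\<Sum>i = 1..<j. ms i) + i"
      by (auto simp: set_fibre)
    obtain l where l: "l \<in> {1..fibre_card n t (t a)}" "a = fibre n t (t a) ! (l - 1)"
      using fibre_rank[OF a(1) refl] by blast
    have ta: "t a \<in> {1..k}" using Sur_range[OF t a(1)] .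
    note s = subst_sur_nth_fibre[OF ta l]
    have "t a = j \<and> ts (t a) l = i"
      by (rule block_unique[of ms]) (use s(1,4) a(2) j i ta in auto)
    with l show "a \<in> set (map ?g ?R)" by (auto simp: set_fibre)
  qed
qed (rule sorted_fibre)

text \<open>A value is hit because its fibre is the image of a fibre of some \<open>ts j\<close>,
  which is nonempty.\<close>

lemma subst_sur_Sur: "subst_sur n t ms ts \<in> Sur n (\<Sum>j = 1..k. ms j)"
proof -
  have blocks: "{1..\<Sum>j = 1..k. ms j} = (\<Union>j\<in>{1..k}. (\<lambda>i. (\<Sum>i = 1..<j. ms i) + i) ` {1..ms j})"
    using arg_cong[OF upt_blocks[of id ms k], of set]
    by (simp add: atLeastLessThanSuc_atLeastAtMost)
  have "subst_sur n t ms ts ` {1..n} = {1..\<Sum>j = 1..k. ms j}"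
  proof (intro equalityI subsetI)
    fix r assume "r \<in> subst_sur n t ms ts ` {1..n}"
    then obtain a where a: "a \<in> {1..n}" "r = subst_sur n t ms ts a" by blast
    obtain l where l: "l \<in> {1..fibre_card n t (t a)}" "a = fibre n t (t a) ! (l - 1)"
      using fibre_rank[OF a(1) refl] by blast
    have ta: "t a \<in> {1..k}" using Sur_range[OF t a(1)] .
    show "r \<in> {1..\<Sum>j = 1..k. ms j}"
      unfolding blocks a(2) using subst_sur_nth_fibre(1,4)[OF ta l] ta by blast
  next
    fix r assume "r \<in> {1..\<Sum>j = 1..k. ms j}"
    then obtain j i where j: "j \<in> {1..k}" and i: "i \<in> {1..ms j}" and r: "r = (\<Sum>i = 1..<j. ms i) + i"
      unfolding blocks by blast
    have "fibre (fibre_card n t j) (ts j) i \<noteq> []"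
      using fibre_card_pos[OF ts[OF j] i] by (auto simp flip: length_fibre)
    then have "fibre n (subst_sur n t ms ts) r \<noteq> []" using fibre_subst_sur[OF j i] r by simp
    then obtain a where "a \<in> set (fibre n (subst_sur n t ms ts) r)" by fastforce
    then show "r \<in> subst_sur n t ms ts ` {1..n}" by (auto simp: set_fibre)
  qed
  moreover have "subst_sur n t ms ts \<in> extensional {1..n}" by (simp add: subst_sur_def)
  ultimately show ?thesis by (auto simp: Sur_def PiE_def)
qed

text \<open>Both sides are stacks over \<open>Leaf 0\<close>, so their lists of corollas are
  compared block by block. The decorations stay arbitrary: the identity is used for undecorated
  combs and for combs decorated by operations.\<close>

lemma subst_tree_comb:
  assumes "\<And>j. j \<in> {1..k} \<Longrightarrow> length (xss j) = ms j"
  shows "subst_tree (comb n t (map (\<lambda>j. comb (fibre_card n t j) (ts j) (xss j)) [1..<k + 1])) =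
    comb n (subst_sur n t ms ts) (concat (map xss [1..<k + 1]))"
proof -
  define q where "q j = zip (xss j) (map (fibre (fibre_card n t j) (ts j)) [1..<length (xss j) + 1])" for j
  define ps where "ps = map (\<lambda>j. (q j, fibre n t j)) [1..<k + 1]"
  have "comb n t (map (\<lambda>j. comb (fibre_card n t j) (ts j) (xss j)) [1..<k + 1]) =
    stack (Leaf 0) (map (apfst (stack (Leaf 0))) ps)"
    unfolding ps_def comb_def q_def
    by (simp add: comp_def zip_map_map zip_same_conv_map)
  also have "subst_tree \<dots> =
    stack (Leaf 0) (concat (map (\<lambda>(q, A). map (apsnd (map (\<lambda>l. A ! (l - 1)))) q) ps))"
    by (subst subst_tree_stack)
      (auto simp: ps_def q_def length_fibre set_fibre set_zip)
  also have "concat (map (\<lambda>(q, A). map (apsnd (map (\<lambda>l. A ! (l - 1)))) q) ps) =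
    concat (map (\<lambda>j. zip (xss j) (map (\<lambda>i. fibre n (subst_sur n t ms ts) ((\<Sum>i = 1..<j. ms i) + i))
      [1..<ms j + 1])) [1..<k + 1])"
    unfolding ps_def map_map comp_def
  proof (intro arg_cong[where f = concat] map_cong refl)
    fix j assume "j \<in> set [1..<k + 1]"
    then have j: "j \<in> {1..k}" by auto
    have *: "map (\<lambda>i. fibre n (subst_sur n t ms ts) ((\<Sum>i = 1..<j. ms i) + i)) [1..<ms j + 1] =
      map (map (\<lambda>l. fibre n t j ! (l - 1))) (map (fibre (fibre_card n t j) (ts j)) [1..<ms j + 1])"
      using fibre_subst_sur[OF j] by auto
    show "(case (q j, fibre n t j) of (q, A) \<Rightarrow> map (apsnd (map (\<lambda>l. A ! (l - 1)))) q) =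
      zip (xss j) (map (\<lambda>i. fibre n (subst_sur n t ms ts) ((\<Sum>i = 1..<j. ms i) + i)) [1..<ms j + 1])"
      unfolding * using assms[OF j]
      by (simp only: q_def prod.case zip_map2 apsnd_def map_prod_def split_def id_apply fst_conv snd_conv)
  qed
  also have "\<dots> = zip (concat (map xss [1..<k + 1]))
    (map (fibre n (subst_sur n t ms ts)) [1..<(\<Sum>j = 1..k. ms j) + 1])"
  proof -
    have "concat (map (\<lambda>j. zip (f j) (g j)) js) = zip (concat (map f js)) (concat (map g js))"
      if "\<And>j. j \<in> set js \<Longrightarrow> length (f j) = length (g j)" for f :: "nat \<Rightarrow> 'c list" and g :: "nat \<Rightarrow> 'd list" and js
      using that by (induction js) auto
    then show ?thesis
      unfolding upt_blocks by this (use assms in auto)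
  qed
  also have "(\<Sum>j = 1..k. ms j) = length (concat (map xss [1..<k + 1]))"
    using assms by (rule length_concat_blocks[symmetric])
  finally show ?thesis by (simp add: comb_def)
qed

end

lemma subst_sur_cong:
  assumes "\<And>a. a \<in> {1..n} \<Longrightarrow> ts (t a) = ts' (t a)"
  shows "subst_sur n t ms ts = subst_sur n t ms ts'"
  unfolding subst_sur_def using assms by (intro restrict_ext) simp

lemma shuffle_left_combs_subst:
  assumes \<tau>: "\<tau> \<in> shuffle_left_combs n k"
    and \<tau>s: "\<forall>j \<in> {1..k}. arity (vertices \<tau> ! (j - 1)) = ns j + 1 \<and>
      \<tau>s j \<in> shuffle_left_combs (ns j) (ms j)"
  shows "subst_tree (decorate \<tau> (map \<tau>s [1..<k + 1])) \<in> shuffle_left_combs n (\<Sum>j = 1..k. ms j)"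
    and "sur_of_comb n (subst_tree (decorate \<tau> (map \<tau>s [1..<k + 1]))) =
      subst_sur n (sur_of_comb n \<tau>) ms (\<lambda>j. sur_of_comb (ns j) (\<tau>s j))"
proof -
  obtain t xs where comb: "t \<in> Sur n k" "length xs = k" "\<tau> = comb n t xs"
    using \<tau> by (rule shuffle_left_comb_eq_comb)
  \<comment> \<open>The arity of a vertex counts the left-most input besides the fibre, so the
    prescribed arities force \<open>ns j\<close> to be the size of the fibre.\<close>
  have ns: "ns j = fibre_card n t j" if "j \<in> {1..k}" for j
  proof -
    from that comb(2) have "j \<in> {1..length xs}" by simp
    then obtain u where "vertices \<tau> ! (j - 1) = Node (xs ! (j - 1)) (u # map Leaf (fibre n t j))"
      unfolding comb(3) by (rule vertex_comb)
    with bspec[OF \<tau>s that] show ?thesis by (simp add: length_fibre)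
  qed
  have "\<exists>p. fst p \<in> Sur (fibre_card n t j) (ms j) \<and> length (snd p) = ms j \<and>
      \<tau>s j = comb (fibre_card n t j) (fst p) (snd p)" if "j \<in> {1..k}" for j
  proof -
    have "\<tau>s j \<in> shuffle_left_combs (fibre_card n t j) (ms j)"
      using \<tau>s ns that by auto
    then show ?thesis by (rule shuffle_left_comb_eq_comb) auto
  qed
  then obtain p where p: "\<And>j. j \<in> {1..k} \<Longrightarrow> fst (p j) \<in> Sur (fibre_card n t j) (ms j) \<and>
      length (snd (p j)) = ms j \<and> \<tau>s j = comb (fibre_card n t j) (fst (p j)) (snd (p j))"
    by metis
  define ts where "ts j = fst (p j)" for j
  define xss where "xss j = snd (p j)" for j
  interpret surjection_substitution n k t ms ts
    by standard (use comb(1) p in \<open>auto simp: ts_def\<close>)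
  have xss: "length (xss j) = ms j" if "j \<in> {1..k}" for j
    using p[OF that] by (simp add: xss_def)
  have "decorate \<tau> (map \<tau>s [1..<k + 1]) =
      comb n t (map (\<lambda>j. comb (fibre_card n t j) (ts j) (xss j)) [1..<k + 1])"
  proof -
    have "map \<tau>s [1..<k + 1] = map (\<lambda>j. comb (fibre_card n t j) (ts j) (xss j)) [1..<k + 1]"
      using p by (intro map_cong refl) (auto simp: ts_def xss_def)
    then show ?thesis by (simp only: comb(3)) (simp add: decorate_comb comb(2))
  qed
  then have eq: "subst_tree (decorate \<tau> (map \<tau>s [1..<k + 1])) =
      comb n (subst_sur n t ms ts) (concat (map xss [1..<k + 1]))"
    using subst_tree_comb[OF xss] by simp
  have len: "length (concat (map xss [1..<k + 1])) = (\<Sum>j = 1..k. ms j)"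
    using xss by (rule length_concat_blocks)
  show "subst_tree (decorate \<tau> (map \<tau>s [1..<k + 1])) \<in> shuffle_left_combs n (\<Sum>j = 1..k. ms j)"
    unfolding eq using comb_in_shuffle_left_combs[of _ n "concat (map xss [1..<k + 1])"]
    by (simp only: len subst_sur_Sur)
  \<comment> \<open>The two families agree only on indices in \<open>{1..k}\<close>, which suffices
    because \<open>subst_sur\<close> evaluates them at values of \<open>t\<close>.\<close>
  have "subst_sur n t ms ts = subst_sur n t ms (\<lambda>j. sur_of_comb (ns j) (\<tau>s j))"
  proof (rule subst_sur_cong)
    fix a assume "a \<in> {1..n}"
    then have ta: "t a \<in> {1..k}" using Sur_range comb(1) by blast
    from p[OF this] have "sur_of_comb (fibre_card n t (t a)) (\<tau>s (t a)) = ts (t a)"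
      using sur_of_comb_comb[of "ts (t a)" _ "xss (t a)"] by (simp add: ts_def xss_def)
    then show "ts (t a) = sur_of_comb (ns (t a)) (\<tau>s (t a))" using ns[OF ta] by simp
  qed
  moreover have "sur_of_comb n \<tau> = t" using comb sur_of_comb_comb by auto
  moreover have "sur_of_comb n (comb n (subst_sur n t ms ts) (concat (map xss [1..<k + 1]))) =
      subst_sur n t ms ts"
    by (rule sur_of_comb_comb) (simp only: len subst_sur_Sur)
  ultimately show "sur_of_comb n (subst_tree (decorate \<tau> (map \<tau>s [1..<k + 1]))) =
      subst_sur n (sur_of_comb n \<tau>) ms (\<lambda>j. sur_of_comb (ns j) (\<tau>s j))"
    by (simp only: eq)
qed


section \<open>The permutad of a shuffle operad\<close>

lemma in_listset_iff: "xs \<in> listset As \<longleftrightarrow> list_all2 (\<in>) xs As"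
  by (induction As arbitrary: xs) (auto simp: set_Cons_def list_all2_Cons2)

lemma in_listset_map_iff:
  "xs \<in> listset (map A ys) \<longleftrightarrow> length xs = length ys \<and> (\<forall>i < length ys. xs ! i \<in> A (ys ! i))"
  by (auto simp: in_listset_iff list_all2_conv_all_nth)

text \<open>Needed because \<open>restrict_to_combs\<close> takes the number of vertices from the
  length of its argument: it agrees with the operadic composition along a fixed comb only on lists
  of the right length. Updating an entry keeps the length.\<close>

lemma multilinear_cong:
  assumes "\<And>xs. length xs = length Ms \<Longrightarrow> f xs = g xs" and "multilinear K Ms N g"
  shows "multilinear K Ms N f"
proof -
  have "f xs = g xs" "f (xs[i := x]) = g (xs[i := x])" if "xs \<in> listset (map carrier Ms)" for xs i x
    using that assms(1) by (simp_all add: in_listset_map_iff)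
  then show ?thesis using assms(2) unfolding multilinear_def by (simp cong: ball_cong)
qed

lemma shuffle_tree_comb: "t \<in> Sur n (length xs) \<Longrightarrow> shuffle_tree n (comb n t xs)"
  using comb_in_shuffle_left_combs by (auto simp: shuffle_left_combs_def)

lemma restrict_to_combs_eq:
  assumes "t \<in> Sur n (length xs)"
  shows "restrict_to_combs \<gamma> n t xs = \<gamma> (comb n t xs)"
  by (simp add: restrict_to_combs_def comb_of_sur_eq[OF assms] decorate_comb)

lemma const_Sur: "n \<ge> 1 \<Longrightarrow> (\<lambda>a\<in>{1..n}. 1) \<in> Sur n 1"
  by (auto simp: Sur_def)

lemma comb_const: "comb n (\<lambda>a\<in>{1..n}. 1) [\<mu>] = corolla n \<mu>"
proof -
  have "fibre n (\<lambda>a\<in>{1..n}. 1) (Suc 0) = [1..<n + 1]"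
    by (auto simp: fibre_def intro!: filter_True)
  moreover have "[0..<n + 1] = 0 # [1..<n + 1]" by (simp add: upt_rec)
  ultimately show ?thesis by (simp add: comb_def corolla_def upt_rec)
qed

context shuffle_operad
begin

text \<open>Associativity is \<open>\<gamma>_assoc\<close> for the comb of \<open>t\<close> whose
  vertices carry the combs of the \<open>ts j\<close>. Substituting yields the comb of the
  substituted surjection, and applying \<open>\<gamma>\<close> to the decorations yields the nested
  composite.\<close>

theorem permutad_restrict_to_combs: "permutad K P e (restrict_to_combs \<gamma>)"
proof (intro permutad.intro permutad_axioms.intro)
  show "arity_graded_module K P e" by (rule arity_graded_module_axioms)
next
  fix n t k assume "n \<ge> 1" and t: "t \<in> Sur n k"
  let ?\<tau> = "comb n t (replicate k ())"
  have t': "t \<in> Sur n (length (replicate k ()))" using t by simp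
  have Ms: "map (\<lambda>v. P (arity v)) (vertices ?\<tau>) = map (\<lambda>j. P (fibre_card n t j + 1)) [1..<k + 1]"
    using map_arity_vertices_comb[of P n t "replicate k ()"] by simp
  show "multilinear K (map (\<lambda>j. P (fibre_card n t j + 1)) [1..<k + 1]) (P (n + 1)) (restrict_to_combs \<gamma> n t)"
  proof (rule multilinear_cong)
    show "multilinear K (map (\<lambda>j. P (fibre_card n t j + 1)) [1..<k + 1]) (P (n + 1)) (\<lambda>xs. \<gamma> (decorate ?\<tau> xs))"
      using \<gamma>_multilinear[OF shuffle_tree_comb[OF t']] unfolding Ms .
    fix xs :: "'a list" assume "length xs = length (map (\<lambda>j. P (fibre_card n t j + 1)) [1..<k + 1])"
    then have "length xs = k" by simp
    with t show "restrict_to_combs \<gamma> n t xs = \<gamma> (decorate ?\<tau> xs)"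
      by (simp add: restrict_to_combs_eq decorate_comb)
  qed
next
  fix n \<mu> assume "n \<ge> 1" "\<mu> \<in> carrier (P (n + 1))"
  then show "restrict_to_combs \<gamma> n (\<lambda>a\<in>{1..n}. 1) [\<mu>] = \<mu>"
    using const_Sur[of n] \<gamma>_corolla[of n \<mu>]
    by (subst restrict_to_combs_eq) (simp_all add: comb_const[simplified])
next
  fix n t k ts ms xss
  assume "n \<ge> 1" and t: "t \<in> Sur n k"
    and *: "\<forall>j \<in> {1..k}. ts j \<in> Sur (fibre_card n t j) (ms j) \<and>
        xss j \<in> listset (map (\<lambda>i. carrier (P (fibre_card (fibre_card n t j) (ts j) i + 1)))
                 [1..<ms j + 1])"
  then interpret surjection_substitution n k t ms ts by unfold_locales auto
  have len: "length (xss j) = ms j" if "j \<in> {1..k}" for j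
    using * that by (auto simp: in_listset_map_iff)
  have ts_Sur: "ts j \<in> Sur (fibre_card n t j) (length (xss j))" if "j \<in> {1..k}" for j
    using ts len that by simp
  let ?T = "comb n t (map (\<lambda>j. comb (fibre_card n t j) (ts j) (xss j)) [1..<k + 1])"
  have "restrict_to_combs \<gamma> n (subst_sur n t ms ts) (concat (map xss [1..<k + 1])) =
      \<gamma> (comb n (subst_sur n t ms ts) (concat (map xss [1..<k + 1])))"
    by (rule restrict_to_combs_eq) (simp only: length_concat_blocks[OF len] subst_sur_Sur)
  also have "comb n (subst_sur n t ms ts) (concat (map xss [1..<k + 1])) = subst_tree ?T"
    by (rule subst_tree_comb[OF len, symmetric])
  also have "\<gamma> (subst_tree ?T) = \<gamma> (map_ptree \<gamma> ?T)"
  proof (rule \<gamma>_assoc)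
    show "shuffle_tree n ?T" by (rule shuffle_tree_comb) (simp add: t)
    show "\<forall>v \<in> set (vertices ?T). shuffle_tree (arity v - 1) (decoration v) \<and>
        (\<forall>w \<in> set (vertices (decoration v)). decoration w \<in> carrier (P (arity w)))"
    proof (rule ballI)
      fix v assume "v \<in> set (vertices ?T)"
      then obtain j u where "j \<in> {1..length [1..<k + 1]}" and
        v: "v = Node (map (\<lambda>j. comb (fibre_card n t j) (ts j) (xss j)) [1..<k + 1] ! (j - 1))
          (u # map Leaf (fibre n t j))"
        by (rule vertex_combE) auto
      then have j: "j \<in> {1..k}" by simp
      then have dec: "decoration v = comb (fibre_card n t j) (ts j) (xss j)"
        and ar: "arity v - 1 = fibre_card n t j"
        by (auto simp: v length_fibre)
      have "decoration w \<in> carrier (P (arity w))" if "w \<in> set (vertices (decoration v))" for w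
        using that unfolding dec
      proof (rule vertex_combE)
        fix i u assume i: "i \<in> {1..length (xss j)}"
          and w: "w = Node (xss j ! (i - 1)) (u # map Leaf (fibre (fibre_card n t j) (ts j) i))"
        have "i - 1 < ms j" using i len[OF j] by auto
        moreover have "xss j \<in> listset (map (\<lambda>i. carrier (P (fibre_card (fibre_card n t j) (ts j) i + 1)))
            [1..<ms j + 1])" using * j by blast
        ultimately have "xss j ! (i - 1) \<in>
            carrier (P (fibre_card (fibre_card n t j) (ts j) ([1..<ms j + 1] ! (i - 1)) + 1))"
          by (simp add: in_listset_map_iff)
        with i len[OF j] show ?thesis by (auto simp: w length_fibre)
      qed
      then show "shuffle_tree (arity v - 1) (decoration v) \<and>
          (\<forall>w \<in> set (vertices (decoration v)). decoration w \<in> carrier (P (arity w)))"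
        unfolding ar using dec shuffle_tree_comb[OF ts_Sur[OF j]] by simp
    qed
  qed
  also have "map_ptree \<gamma> ?T = comb n t (map (\<lambda>j. restrict_to_combs \<gamma> (fibre_card n t j) (ts j) (xss j)) [1..<k + 1])"
    unfolding map_ptree_comb map_map comp_def using ts_Sur
    by (intro arg_cong[where f = "comb n t"] map_cong refl restrict_to_combs_eq[symmetric]) auto
  also have "\<gamma> \<dots> = restrict_to_combs \<gamma> n t (map (\<lambda>j. restrict_to_combs \<gamma> (fibre_card n t j) (ts j) (xss j)) [1..<k + 1])"
    by (rule restrict_to_combs_eq[symmetric]) (simp add: t)
  finally show "restrict_to_combs \<gamma> n (subst_sur n t ms ts) (concat (map xss [1..<k + 1])) =
    restrict_to_combs \<gamma> n t (map (\<lambda>j. restrict_to_combs \<gamma> (fibre_card n t j) (ts j) (xss j)) [1..<k + 1])" .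
qed

end

section \<open>Positions in concatenated blocks\<close>

abbreviation offset :: "nat list \<Rightarrow> nat \<Rightarrow> nat" where
  "offset ns j \<equiv> sum_list (take j ns)"

lemma offset_less: "\<lbrakk>j < length ns; b < ns ! j\<rbrakk> \<Longrightarrow> offset ns j + b < sum_list ns"
proof (induction ns arbitrary: j)
  case (Cons i ns)
  then show ?case by (cases j) auto
qed simp

lemma offset_surj:
  "p < sum_list ns \<Longrightarrow> \<exists>j b. j < length ns \<and> b < ns ! j \<and> p = offset ns j + b"
proof (induction ns arbitrary: p)
  case (Cons i ns)
  show ?case
  proof (cases "p < i")
    case True
    then show ?thesis by (intro exI[of _ 0] exI[of _ p]) simp
  next
    case False
    then have "p - i < sum_list ns" using Cons.prems by simp
    then obtain j b where "j < length ns" "b < ns ! j" "p - i = offset ns j + b"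
      using Cons.IH by blast
    with False show ?thesis by (intro exI[of _ "Suc j"] exI[of _ b]) simp
  qed
qed simp

lemma offset_inj:
  assumes "offset ns j + b = offset ns j' + b'" "j < length ns" "b < ns ! j" "j' < length ns" "b' < ns ! j'"
  shows "j = j' \<and> b = b'"
  using assms
proof (induction ns arbitrary: j j')
  case (Cons i ns)
  show ?case
    using Cons.prems Cons.IH[of "j - 1" "j' - 1"] by (cases j; cases j') simp_all
qed simp

lemma concat_nth_offset:
  "\<lbrakk>j < length xss; b < length (xss ! j)\<rbrakk> \<Longrightarrow> concat xss ! (offset (map length xss) j + b) = xss ! j ! b"
proof (induction xss arbitrary: j)
  case (Cons xs xss)
  then show ?case by (cases j) (auto simp: nth_append)
qed simp

text \<open>Positions in a concatenation are coordinatised by a block and a place in it, so that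
  permutations of positions can be described by their effect on such pairs.\<close>

lemma block_bij:
  "bij_betw (\<lambda>(j, b). offset ns j + b) (SIGMA j:{..<length ns}. {..<ns ! j}) {..<sum_list ns}"
  unfolding bij_betw_def
proof
  show "inj_on (\<lambda>(j, b). offset ns j + b) (SIGMA j:{..<length ns}. {..<ns ! j})"
  proof (rule inj_onI)
    fix x y
    assume *: "x \<in> (SIGMA j:{..<length ns}. {..<ns ! j})" "y \<in> (SIGMA j:{..<length ns}. {..<ns ! j})"
      "(\<lambda>(j, b). offset ns j + b) x = (\<lambda>(j, b). offset ns j + b) y"
    obtain j b j' b' where "x = (j, b)" "y = (j', b')" by (cases x; cases y)
    with * offset_inj[of j ns b j' b'] show "x = y" by simp
  qed
  show "(\<lambda>(j, b). offset ns j + b) ` (SIGMA j:{..<length ns}. {..<ns ! j}) = {..<sum_list ns}"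
  proof (intro equalityI subsetI)
    fix p assume "p \<in> {..<sum_list ns}"
    then obtain j b where "j < length ns" "b < ns ! j" "p = offset ns j + b"
      using offset_surj by blast
    then show "p \<in> (\<lambda>(j, b). offset ns j + b) ` (SIGMA j:{..<length ns}. {..<ns ! j})"
      by (intro image_eqI[of _ _ "(j, b)"]) simp_all
  qed (auto simp: offset_less)
qed

text \<open>The equivariance axioms speak of a \<open>\<beta>\<close> with prescribed values, whose
  existence has to be supplied: decode a position, apply \<open>\<phi>\<close>, encode again, and
  fix everything beyond the total length. The two totals agree because \<open>\<phi>\<close> is a
  bijection.\<close>

lemma block_permutation:
  assumes "bij_betw \<phi> (SIGMA j:{..<length ns}. {..<ns ! j}) (SIGMA j:{..<length ms}. {..<ms ! j})"
  obtains \<beta> where "\<beta> permutes {..<sum_list ns}"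
    "\<forall>j < length ns. \<forall>b < ns ! j. \<beta> (offset ns j + b) = (case \<phi> (j, b) of (i, c) \<Rightarrow> offset ms i + c)"
proof -
  let ?A = "SIGMA j:{..<length ns}. {..<ns ! j}"
  let ?enc = "\<lambda>ns (j, b). offset ns j + b :: nat"
  let ?dec = "inv_into ?A (?enc ns)"
  define \<beta> where "\<beta> p = (if p < sum_list ns then ?enc ms (\<phi> (?dec p)) else p)" for p
  have bij: "bij_betw (?enc ms \<circ> (\<phi> \<circ> ?dec)) {..<sum_list ns} {..<sum_list ms}"
    by (rule bij_betw_trans[OF bij_betw_trans[OF bij_betw_inv_into[OF block_bij] assms] block_bij])
  then have "sum_list ns = sum_list ms" using bij_betw_same_card by fastforce
  with bij have "bij_betw (?enc ms \<circ> (\<phi> \<circ> ?dec)) {..<sum_list ns} {..<sum_list ns}" by simp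
  also have "?this \<longleftrightarrow> bij_betw \<beta> {..<sum_list ns} {..<sum_list ns}"
    by (intro bij_betw_cong) (simp add: \<beta>_def)
  finally have "\<beta> permutes {..<sum_list ns}"
    by (rule bij_imp_permutes) (simp add: \<beta>_def)
  moreover have "\<beta> (offset ns j + b) = (case \<phi> (j, b) of (i, c) \<Rightarrow> offset ms i + c)"
    if "j < length ns" "b < ns ! j" for j b
  proof -
    have "?dec (?enc ns (j, b)) = (j, b)"
      using that block_bij[of ns] by (intro inv_into_f_f) (auto simp: bij_betw_def)
    then show ?thesis using offset_less that by (simp add: \<beta>_def)
  qed
  ultimately show thesis by (intro that) blast+
qed

text \<open>For a leaf word this sends positions to labels; it is the map whose inverse acts in
  \<open>shuffle_of_symmetric\<close>.\<close>

abbreviation list_perm :: "nat list \<Rightarrow> nat \<Rightarrow> nat" where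
  "list_perm ls \<equiv> \<lambda>p. if p < length ls then ls ! p else p"

lemma list_perm_permutes:
  assumes "distinct ls" "set ls = {..<length ls}"
  shows "list_perm ls permutes {..<length ls}"
proof (rule bij_imp_permutes)
  have "bij_betw ((!) ls) {..<length ls} {..<length ls}"
    using assms by (intro bij_betw_nth) auto
  also have "?this \<longleftrightarrow> bij_betw (list_perm ls) {..<length ls} {..<length ls}"
    by (intro bij_betw_cong) simp
  finally show "bij_betw (list_perm ls) {..<length ls} {..<length ls}" .
qed simp

lemma permute_list_list_perm:
  "length xs = length ls \<Longrightarrow> permute_list (list_perm ls) xs = map (\<lambda>l. xs ! l) ls"
  by (rule nth_equalityI) (simp_all add: permute_list_def)


section \<open>Composition of multilinear maps\<close>

definition linear_map :: "'k ring \<Rightarrow> ('k, 'a) module \<Rightarrow> ('k, 'b) module \<Rightarrow> ('a \<Rightarrow> 'b) \<Rightarrow> bool" where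
  "linear_map K M N h \<longleftrightarrow>
    (\<forall>x \<in> carrier M. h x \<in> carrier N \<and>
       (\<forall>y \<in> carrier M. h (x \<oplus>\<^bsub>M\<^esub> y) = h x \<oplus>\<^bsub>N\<^esub> h y) \<and>
       (\<forall>c \<in> carrier K. h (c \<odot>\<^bsub>M\<^esub> x) = c \<odot>\<^bsub>N\<^esub> h x))"

lemma linear_map_comp:
  "\<lbrakk>linear_map K M N f; linear_map K N L g\<rbrakk> \<Longrightarrow> linear_map K M L (\<lambda>x. g (f x))"
  by (simp add: linear_map_def)

lemma listset_length: "xs \<in> listset As \<Longrightarrow> length xs = length As"
  by (simp add: in_listset_iff list_all2_lengthD)

lemma listset_append:
  "xs \<in> listset (As @ Bs) \<longleftrightarrow> take (length As) xs \<in> listset As \<and> drop (length As) xs \<in> listset Bs"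
proof
  assume "xs \<in> listset (As @ Bs)"
  then show "take (length As) xs \<in> listset As \<and> drop (length As) xs \<in> listset Bs"
    by (auto simp: in_listset_iff list_all2_append2)
next
  assume "take (length As) xs \<in> listset As \<and> drop (length As) xs \<in> listset Bs"
  then show "xs \<in> listset (As @ Bs)"
    using list_all2_appendI[of "(\<in>)" "take (length As) xs" As "drop (length As) xs" Bs]
    by (simp add: in_listset_iff)
qed

lemma listset_update:
  "\<lbrakk>xs \<in> listset (map A ys); x \<in> A (ys ! i)\<rbrakk> \<Longrightarrow> xs[i := x] \<in> listset (map A ys)"
  by (cases "i < length xs") (auto simp: in_listset_map_iff nth_list_update)

text \<open>Splits multilinearity into linearity in single slots, so that composites can be treated
  one slot at a time. The closure part of \<open>linear_map\<close> comes from the values on updated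
  lists, which stay in the product of the carriers.\<close>

lemma multilinear_iff:
  "multilinear K Ms N f \<longleftrightarrow> (\<forall>xs \<in> listset (map carrier Ms). f xs \<in> carrier N \<and>
     (\<forall>i < length Ms. linear_map K (Ms ! i) N (\<lambda>z. f (xs[i := z]))))"
  unfolding multilinear_def linear_map_def by (auto intro: listset_update)

lemma multilinear_linear_comp:
  assumes "multilinear K Ms N f" "linear_map K N L g"
  shows "multilinear K Ms L (\<lambda>xs. g (f xs))"
  unfolding multilinear_iff
proof (intro ballI conjI allI impI)
  fix xs i assume xs: "xs \<in> listset (map carrier Ms)"
  with assms show "g (f xs) \<in> carrier L"
    by (simp add: multilinear_iff linear_map_def)
  assume "i < length Ms"
  with xs assms(1) show "linear_map K (Ms ! i) L (\<lambda>z. g (f (xs[i := z])))"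
    by (intro linear_map_comp[OF _ assms(2)]) (simp add: multilinear_iff)
qed

lemma multilinear_single: "multilinear K [M] N (\<lambda>xs. h (hd xs)) \<longleftrightarrow> linear_map K M N h"
  by (auto simp: multilinear_iff set_Cons_def linear_map_def)

lemma leaves_decorate: "leaves (decorate T xs) = leaves T"
  and leaves_decorate_list: "map leaves (decorate_list Ts xs) = map leaves Ts"
  for xs :: "'b list"
proof -
  show "leaves (decorate T xs) = leaves T" for T and xs :: "'b list"
  proof (induction T arbitrary: xs)
    case (Node v ts)
    then have "\<forall>t \<in> set ts. \<forall>xs :: 'b list. leaves (decorate t xs) = leaves t" by blast
    then have "map leaves (decorate_list ts xs) = map leaves ts" for xs :: "'b list"
      by (induction ts arbitrary: xs) auto
    then show ?case by simp
  qed simp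
  then show "map leaves (decorate_list Ts xs) = map leaves Ts"
    by (induction Ts arbitrary: xs) auto
qed


section \<open>The shuffle operad of a symmetric operad\<close>

context symmetric_operad
begin

lemma cmp_closed:
  assumes "ns \<noteq> []" "\<forall>i \<in> set ns. i \<ge> 1" "\<mu> \<in> carrier (P (length ns))"
    "\<nu>s \<in> listset (map (\<lambda>i. carrier (P i)) ns)"
  shows "cmp ns \<mu> \<nu>s \<in> carrier (P (sum_list ns))"
proof -
  have "\<mu> # \<nu>s \<in> listset (map carrier (P (length ns) # map P ns))"
    using assms(3,4) by (simp add: comp_def set_Cons_def)
  with comp_multilinear[OF assms(1,2)] show ?thesis
    unfolding multilinear_iff by fastforce
qed

lemma act_linear_map:
  "\<lbrakk>n \<ge> 1; \<sigma> permutes {..<n}\<rbrakk> \<Longrightarrow> linear_map K (P n) (P n) (\<lambda>\<mu>. act n \<mu> \<sigma>)"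
  using act_linear multilinear_single[of K "P n" "P n" "\<lambda>\<mu>. act n \<mu> \<sigma>"] by simp

lemma act_closed:
  "\<lbrakk>n \<ge> 1; \<sigma> permutes {..<n}; \<mu> \<in> carrier (P n)\<rbrakk> \<Longrightarrow> act n \<mu> \<sigma> \<in> carrier (P n)"
  using act_linear_map by (simp add: linear_map_def)

section \<open>Planar composition and grafting\<close>

abbreviation planar :: "'a ptree \<Rightarrow> 'a" where
  "planar \<equiv> planar_comp cmp e"

text \<open>Asks nothing of the labels, hence passes to subtrees. Nonempty inputs give every subtree
  a leaf, as the positive arities in the axioms for \<open>cmp\<close> demand.\<close>

definition composable :: "'a ptree \<Rightarrow> bool" where
  "composable T \<longleftrightarrow> (\<forall>v \<in> set (vertices T). inputs v \<noteq> [] \<and> decoration v \<in> carrier (P (arity v)))"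

lemma composable_Leaf: "composable (Leaf l)"
  by (simp add: composable_def)

lemma composable_Node:
  "composable (Node \<mu> ts) \<longleftrightarrow> ts \<noteq> [] \<and> \<mu> \<in> carrier (P (length ts)) \<and> (\<forall>t \<in> set ts. composable t)"
  by (auto simp: composable_def)

lemma composable_planar:
  "composable T \<Longrightarrow> length (leaves T) \<ge> 1 \<and> planar T \<in> carrier (P (length (leaves T)))"
proof (induction T)
  case (Leaf l)
  show ?case using id_carrier by simp
next
  case (Node \<mu> ts)
  then have IH: "length (leaves t) \<ge> 1" "planar t \<in> carrier (P (length (leaves t)))" if "t \<in> set ts" for t
    using that by (auto simp: composable_Node)
  have "planar (Node \<mu> ts) \<in> carrier (P (sum_list (map (\<lambda>t. length (leaves t)) ts)))"
    unfolding planar_comp.simps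
    by (rule cmp_closed) (use Node.prems IH in \<open>auto simp: composable_Node in_listset_map_iff\<close>)
  moreover have "ts \<noteq> []" using Node.prems by (simp add: composable_Node)
  then obtain t ts' where "ts = t # ts'" by (cases ts) auto
  ultimately show ?case using IH[of t] by (simp add: length_concat comp_def)
qed

lemma leaves_graft: "leaves (graft S us) = concat (map (\<lambda>l. leaves (us ! l)) (leaves S))"
proof (induction S)
  case (Node v ts)
  then show ?case by (induction ts) auto
qed simp

text \<open>A leaf is the left unit axiom, a vertex is one use of \<open>comp_assoc\<close>. The
  grafted trees appear in the order of the leaf word of \<open>S\<close>, not in the order of
  \<open>us\<close>; this discrepancy is what the relabelling of \<open>S\<close> has to
  compensate.\<close>

lemma planar_graft:
  assumes "composable S"
    and us: "\<And>l. l \<in> set (leaves S) \<Longrightarrow> composable (us ! l)"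
  shows "planar (graft S us) =
    cmp (map (\<lambda>l. length (leaves (us ! l))) (leaves S)) (planar S) (map (\<lambda>l. planar (us ! l)) (leaves S))"
  using assms
proof (induction S)
  case (Leaf l)
  then show ?case using composable_planar[of "us ! l"] by (simp add: comp_id_left)
next
  case (Node \<mu> ts)
  let ?N = "\<lambda>l. length (leaves (us ! l))" and ?V = "\<lambda>l. planar (us ! l)"
  let ?iss = "map (\<lambda>t. map ?N (leaves t)) ts" and ?xss = "map (\<lambda>t. map ?V (leaves t)) ts"
  have t: "composable t" "length (leaves t) \<ge> 1" "planar t \<in> carrier (P (length (leaves t)))"
    if "t \<in> set ts" for t
    using Node.prems(1) composable_planar[of t] that by (auto simp: composable_Node)
  have u: "?N l \<ge> 1" "?V l \<in> carrier (P (?N l))" if "t \<in> set ts" "l \<in> set (leaves t)" for t l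
    using composable_planar[of "us ! l"] Node.prems(2)[of l] that by auto
  have "cmp (concat ?iss) (cmp (map length ?iss) \<mu> (map planar ts)) (concat ?xss) =
      cmp (map sum_list ?iss) \<mu> (map (\<lambda>j. cmp (?iss ! j) (map planar ts ! j) (?xss ! j)) [0..<length ?iss])"
  proof (rule comp_assoc)
    show "?iss \<noteq> []" "\<mu> \<in> carrier (P (length ?iss))"
      using Node.prems(1) by (auto simp: composable_Node)
    show "\<forall>ns\<in>set ?iss. ns \<noteq> [] \<and> (\<forall>i\<in>set ns. 1 \<le> i)"
      using t(2) u(1) by force
    show "map planar ts \<in> listset (map (\<lambda>ns. carrier (P (length ns))) ?iss)"
      using t(3) by (auto simp: in_listset_map_iff)
    show "\<forall>j<length ?iss. ?xss ! j \<in> listset (map (\<lambda>i. carrier (P i)) (?iss ! j))"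
      using u(2) nth_mem by (fastforce simp: in_listset_map_iff)
  qed simp
  also have "map (\<lambda>j. cmp (?iss ! j) (map planar ts ! j) (?xss ! j)) [0..<length ?iss] =
      map (\<lambda>t. planar (graft t us)) ts"
  proof -
    have "planar (graft t us) = cmp (map ?N (leaves t)) (planar t) (map ?V (leaves t))"
      if "t \<in> set ts" for t
      using Node.prems(2) that by (intro Node.IH[OF that t(1)[OF that]]) auto
    then show ?thesis by (intro nth_equalityI) auto
  qed
  finally show ?case
    by (simp add: map_concat leaves_graft length_concat comp_def)
qed


section \<open>Equivariance with explicitly constructed block permutations\<close>

abbreviation sym_comp :: "'a ptree \<Rightarrow> 'a" where
  "sym_comp \<equiv> shuffle_of_symmetric act cmp e"

lemma cmp_act_inner:
  assumes "ns \<noteq> []" "\<forall>i \<in> set ns. i \<ge> 1" "\<mu> \<in> carrier (P (length ns))"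
    "\<nu>s \<in> listset (map (\<lambda>i. carrier (P i)) ns)" "\<And>j. j < length ns \<Longrightarrow> \<rho> j permutes {..<ns ! j}"
  obtains \<beta> where "\<beta> permutes {..<sum_list ns}"
    "\<forall>j < length ns. \<forall>b < ns ! j. \<beta> (offset ns j + b) = offset ns j + \<rho> j b"
    "cmp ns \<mu> (map (\<lambda>j. act (ns ! j) (\<nu>s ! j) (\<rho> j)) [0..<length ns]) = act (sum_list ns) (cmp ns \<mu> \<nu>s) \<beta>"
proof -
  let ?A = "SIGMA j:{..<length ns}. {..<ns ! j}"
  have "bij_betw (\<lambda>(j, b). (j, \<rho> j b)) ?A ?A"
  proof (rule bij_betw_byWitness[where f' = "\<lambda>(j, b). (j, inv_into UNIV (\<rho> j) b)"])
    show "\<forall>p\<in>?A. (\<lambda>(j, b). (j, inv_into UNIV (\<rho> j) b)) ((\<lambda>(j, b). (j, \<rho> j b)) p) = p"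
      using permutes_inverses(2)[OF assms(5)] by auto
    show "\<forall>p\<in>?A. (\<lambda>(j, b). (j, \<rho> j b)) ((\<lambda>(j, b). (j, inv_into UNIV (\<rho> j) b)) p) = p"
      using permutes_inverses(1)[OF assms(5)] by auto
    show "(\<lambda>(j, b). (j, \<rho> j b)) ` ?A \<subseteq> ?A"
      using permutes_in_image[OF assms(5)] by auto
    show "(\<lambda>(j, b). (j, inv_into UNIV (\<rho> j) b)) ` ?A \<subseteq> ?A"
      using permutes_in_image[OF permutes_inv[OF assms(5)]] by auto
  qed
  then obtain \<beta> where \<beta>: "\<beta> permutes {..<sum_list ns}"
    "\<forall>j < length ns. \<forall>b < ns ! j.
      \<beta> (offset ns j + b) = (case (case (j, b) of (j, b) \<Rightarrow> (j, \<rho> j b)) of (i, c) \<Rightarrow> offset ns i + c)"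
    by (rule block_permutation)
  show thesis
  proof (rule that)
    show "\<beta> permutes {..<sum_list ns}" by (rule \<beta>)
    show 2: "\<forall>j < length ns. \<forall>b < ns ! j. \<beta> (offset ns j + b) = offset ns j + \<rho> j b"
      using \<beta>(2) by simp
    show "cmp ns \<mu> (map (\<lambda>j. act (ns ! j) (\<nu>s ! j) (\<rho> j)) [0..<length ns]) = act (sum_list ns) (cmp ns \<mu> \<nu>s) \<beta>"
      by (rule comp_act_inner) (use assms \<beta>(1) 2 in auto)
  qed
qed

text \<open>The axiom is used for the inverse of \<open>\<alpha>\<close>, because
  \<open>shuffle_of_symmetric\<close> acts by the inverse of the label permutation. The operands
  then come out permuted by \<open>\<alpha>\<close>, which for a leaf word is the order in
  \<open>planar_graft\<close>.\<close>

lemma cmp_act_outer: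
  assumes "ns \<noteq> []" "\<forall>i \<in> set ns. i \<ge> 1" "\<mu> \<in> carrier (P (length ns))"
    "\<nu>s \<in> listset (map (\<lambda>i. carrier (P i)) ns)" and \<alpha>: "\<alpha> permutes {..<length ns}"
  obtains \<beta> where "\<beta> permutes {..<sum_list ns}"
    "\<forall>j < length ns. \<forall>b < ns ! j.
      \<beta> (offset ns j + b) = offset (permute_list \<alpha> ns) (inv_into UNIV \<alpha> j) + b"
    "cmp ns (act (length ns) \<mu> (inv_into UNIV \<alpha>)) \<nu>s =
      act (sum_list ns) (cmp (permute_list \<alpha> ns) \<mu> (permute_list \<alpha> \<nu>s)) \<beta>"
proof -
  let ?ms = "permute_list \<alpha> ns" and ?\<sigma> = "inv_into UNIV \<alpha>"
  let ?A = "SIGMA j:{..<length ns}. {..<ns ! j}" and ?B = "SIGMA j:{..<length ?ms}. {..<?ms ! j}"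
  have \<sigma>: "?\<sigma> permutes {..<length ns}" using \<alpha> by (rule permutes_inv)
  have inv: "inv_into UNIV ?\<sigma> = \<alpha>" using \<alpha> by (rule permutes_inv_inv)
  have lt: "\<alpha> j < length ns \<longleftrightarrow> j < length ns" "?\<sigma> j < length ns \<longleftrightarrow> j < length ns" for j
    using permutes_in_image[OF \<alpha>, of j] permutes_in_image[OF \<sigma>, of j] by auto
  have nth: "?ms ! j = ns ! \<alpha> j" if "j < length ns" for j
    using that \<alpha> by (rule permute_list_nth[rotated])
  have "bij_betw (\<lambda>(j, b). (?\<sigma> j, b)) ?A ?B"
    by (rule bij_betw_byWitness[where f' = "\<lambda>(j, b). (\<alpha> j, b)"])
      (auto simp: lt nth permutes_inverses[OF \<alpha>])
  then obtain \<beta> where \<beta>: "\<beta> permutes {..<sum_list ns}"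
    "\<forall>j < length ns. \<forall>b < ns ! j.
      \<beta> (offset ns j + b) = (case (case (j, b) of (j, b) \<Rightarrow> (?\<sigma> j, b)) of (i, c) \<Rightarrow> offset ?ms i + c)"
    by (rule block_permutation)
  show thesis
  proof (rule that)
    show "\<beta> permutes {..<sum_list ns}" by (rule \<beta>)
    show 2: "\<forall>j < length ns. \<forall>b < ns ! j. \<beta> (offset ns j + b) = offset ?ms (?\<sigma> j) + b"
      using \<beta>(2) by simp
    show "cmp ns (act (length ns) \<mu> ?\<sigma>) \<nu>s = act (sum_list ns) (cmp ?ms \<mu> (permute_list \<alpha> \<nu>s)) \<beta>"
      using comp_act_outer[OF assms(1-4) \<sigma> \<beta>(1)] 2 unfolding inv by blast
  qed
qed

section \<open>The two composites of a tree of trees\<close>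

lemma leaves_map_ptree: "leaves (map_ptree f T) = leaves T"
proof (induction T)
  case (Node v ts)
  then show ?case by (simp add: comp_def cong: map_cong)
qed simp

text \<open>Constrains only the decorations, whose labels must enumerate the inputs, and leaves the
  labels of the outer tree free, so that the property passes to subtrees.\<close>

definition substitutable :: "'a ptree ptree \<Rightarrow> bool" where
  "substitutable T \<longleftrightarrow> (\<forall>v \<in> set (vertices T). inputs v \<noteq> [] \<and> composable (decoration v) \<and>
     distinct (leaves (decoration v)) \<and> set (leaves (decoration v)) = {..<arity v})"

lemma substitutable_Node:
  "substitutable (Node S ts) \<longleftrightarrow> ts \<noteq> [] \<and> composable S \<and> distinct (leaves S) \<and>
     set (leaves S) = {..<length ts} \<and> (\<forall>t \<in> set ts. substitutable t)"
  by (auto simp: substitutable_def)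

lemma composable_graft:
  "\<lbrakk>composable S; \<And>l. l \<in> set (leaves S) \<Longrightarrow> composable (us ! l)\<rbrakk> \<Longrightarrow> composable (graft S us)"
  by (induction S) (auto simp: composable_Node)

lemma composable_subst_tree: "substitutable T \<Longrightarrow> composable (subst_tree T)"
proof (induction T)
  case (Node S ts)
  then show ?case by (auto simp: substitutable_Node intro!: composable_graft)
qed (simp add: composable_Leaf)

lemma permute_list_children:
  assumes "set (leaves S) = {..<length ts}" "distinct (leaves S)"
  shows "permute_list (list_perm (leaves S)) (map f ts) = map (\<lambda>l. f (ts ! l)) (leaves S)"
proof -
  have "length (leaves S) = length ts"
    using assms by (metis card_lessThan distinct_card)
  with assms(1) show ?thesis by (subst permute_list_list_perm) auto
qed

text \<open>The leaf word of \<open>S\<close> lists the indices of the children without repetition,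
  so each child is grafted exactly once.\<close>

lemma length_leaves_subst_tree:
  "substitutable T \<Longrightarrow> length (leaves (subst_tree T)) = length (leaves T)"
proof (induction T)
  case (Node S ts)
  then have S: "set (leaves S) = {..<length ts}" "distinct (leaves S)"
    and IH: "\<And>t. t \<in> set ts \<Longrightarrow> length (leaves (subst_tree t)) = length (leaves t)"
    by (auto simp: substitutable_Node)
  have "length (leaves (subst_tree (Node S ts))) = (\<Sum>l\<leftarrow>leaves S. length (leaves (map subst_tree ts ! l)))"
    by (simp add: leaves_graft length_concat comp_def)
  also have "\<dots> = (\<Sum>l\<in>{..<length ts}. length (leaves (map subst_tree ts ! l)))"
    by (simp only: sum_list_distinct_conv_sum_set[OF S(2)] S(1))
  also have "\<dots> = (\<Sum>t\<leftarrow>ts. length (leaves t))"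
    using IH by (simp add: sum_list_sum_nth atLeast0LessThan)
  finally show ?case by (simp add: length_concat comp_def)
qed simp

text \<open>Composing the decorations first and substituting first produce different planar orders
  of the same inputs; \<open>\<rho>\<close> records the difference. It is tied to leaf words, which
  make sense for any labels of \<open>T\<close>.\<close>

lemma planar_map_sym_comp:
  assumes "substitutable T"
  shows "\<exists>\<rho>. \<rho> permutes {..<length (leaves T)} \<and>
      (\<forall>p < length (leaves T). leaves (subst_tree T) ! \<rho> p = leaves T ! p) \<and>
      planar (map_ptree sym_comp T) = act (length (leaves T)) (planar (subst_tree T)) \<rho>"
  using assms
proof (induction T)
  case (Leaf l)
  have "act 1 e id = e" using act_id[of 1 e] id_carrier by simp
  then show ?case
    using permutes_id by (intro exI[of _ id]) (simp add: id_def)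
next
  case (Node S ts)
  let ?L = "\<lambda>t. length (leaves t)"
  let ?ns = "map ?L ts" and ?us = "map subst_tree ts" and ?\<alpha> = "list_perm (leaves S)"
  note * = Node.prems
  have prems: "ts \<noteq> []" "composable S" "distinct (leaves S)" "set (leaves S) = {..<length ts}"
    and sub: "\<And>t. t \<in> set ts \<Longrightarrow> substitutable t"
    using * by (auto simp: substitutable_Node)
  note len = length_leaves_subst_tree[OF sub]
  have len_S: "length (leaves S) = length ts"
    using prems(3,4) by (metis card_lessThan distinct_card)
  have \<alpha>: "?\<alpha> permutes {..<length ts}"
    using list_perm_permutes[of "leaves S"] prems(3,4) len_S by simp
  have ms: "permute_list ?\<alpha> ?ns = map (\<lambda>l. ?L (?us ! l)) (leaves S)"
    using permute_list_children[OF prems(4,3), of ?L] len[OF nth_mem] prems(4) by simp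
  have sum_ns: "sum_list ?ns = ?L (Node S ts)"
    by (simp add: length_concat comp_def)
  have "\<forall>j. \<exists>\<rho>. j < length ts \<longrightarrow> \<rho> permutes {..<?L (ts ! j)} \<and>
      (\<forall>p < ?L (ts ! j). leaves (subst_tree (ts ! j)) ! \<rho> p = leaves (ts ! j) ! p) \<and>
      planar (map_ptree sym_comp (ts ! j)) = act (?L (ts ! j)) (planar (subst_tree (ts ! j))) \<rho>"
    using Node.IH[OF nth_mem] sub[OF nth_mem] by blast
  then obtain \<rho>s where \<rho>s: "\<And>j. j < length ts \<Longrightarrow> \<rho>s j permutes {..<?L (ts ! j)} \<and>
      (\<forall>p < ?L (ts ! j). leaves (subst_tree (ts ! j)) ! \<rho>s j p = leaves (ts ! j) ! p) \<and>
      planar (map_ptree sym_comp (ts ! j)) = act (?L (ts ! j)) (planar (subst_tree (ts ! j))) (\<rho>s j)"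
    by metis
  let ?\<nu>s = "map (\<lambda>t. planar (subst_tree t)) ts"
  have t: "?L t \<ge> 1" "planar (subst_tree t) \<in> carrier (P (?L t))" if "t \<in> set ts" for t
    using composable_planar[OF composable_subst_tree[OF sub[OF that]]] len[OF that] by auto
  have ns: "?ns \<noteq> []" "\<forall>i \<in> set ?ns. i \<ge> 1" "?\<nu>s \<in> listset (map (\<lambda>i. carrier (P i)) ?ns)"
    using prems(1) t by (auto simp: in_listset_map_iff)
  have S: "planar S \<in> carrier (P (length ?ns))"
    using composable_planar[OF prems(2)] len_S by simp
  have \<alpha>': "?\<alpha> permutes {..<length ?ns}" using \<alpha> by simp
  have \<gamma>S: "sym_comp S = act (length ?ns) (planar S) (inv_into UNIV ?\<alpha>)"
    by (simp add: shuffle_of_symmetric_def len_S)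
  have \<gamma>S_closed: "sym_comp S \<in> carrier (P (length ?ns))"
    unfolding \<gamma>S using prems(1) by (intro act_closed S permutes_inv \<alpha>') (cases ts, auto)
  \<comment> \<open>\<open>\<beta>1\<close> collects the permutations of the children, and
    \<open>\<beta>2\<close> below is the block permutation coming from the labels of
    \<open>S\<close>. In the nested right actions \<open>\<beta>1\<close> ends up outermost, which
    gives the product \<open>\<beta>2 \<circ> \<beta>1\<close>.\<close>
  obtain \<beta>1 where \<beta>1: "\<beta>1 permutes {..<sum_list ?ns}"
    "\<forall>j < length ?ns. \<forall>b < ?ns ! j. \<beta>1 (offset ?ns j + b) = offset ?ns j + \<rho>s j b"
    "cmp ?ns (sym_comp S) (map (\<lambda>j. act (?ns ! j) (?\<nu>s ! j) (\<rho>s j)) [0..<length ?ns]) =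
      act (sum_list ?ns) (cmp ?ns (sym_comp S) ?\<nu>s) \<beta>1"
    using ns(1,2) \<gamma>S_closed ns(3) by (rule cmp_act_inner[where \<rho> = \<rho>s]) (use \<rho>s in auto)
  obtain \<beta>2 where \<beta>2: "\<beta>2 permutes {..<sum_list ?ns}"
    "\<forall>j < length ?ns. \<forall>b < ?ns ! j.
      \<beta>2 (offset ?ns j + b) = offset (permute_list ?\<alpha> ?ns) (inv_into UNIV ?\<alpha> j) + b"
    "cmp ?ns (act (length ?ns) (planar S) (inv_into UNIV ?\<alpha>)) ?\<nu>s =
      act (sum_list ?ns) (cmp (permute_list ?\<alpha> ?ns) (planar S) (permute_list ?\<alpha> ?\<nu>s)) \<beta>2"
    using ns(1,2) S ns(3) \<alpha>' by (rule cmp_act_outer)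
  have us: "composable (?us ! l)" if "l \<in> set (leaves S)" for l
    using composable_subst_tree sub that prems(4) by auto
  have "permute_list ?\<alpha> ?\<nu>s = map (\<lambda>l. planar (?us ! l)) (leaves S)"
    using permute_list_children[OF prems(4,3), of "\<lambda>t. planar (subst_tree t)"] prems(4) by simp
  then have sub_eq: "cmp (permute_list ?\<alpha> ?ns) (planar S) (permute_list ?\<alpha> ?\<nu>s) = planar (subst_tree (Node S ts))"
    unfolding ms using planar_graft[OF prems(2) us] by simp
  have sub_closed: "planar (subst_tree (Node S ts)) \<in> carrier (P (sum_list ?ns))"
    using composable_planar[OF composable_subst_tree[OF *]]
    by (simp only: length_leaves_subst_tree[OF *] sum_ns)
  have pos: "sum_list ?ns \<ge> 1"
    using ns(1,2) by (cases ts) auto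
  have "planar (map_ptree sym_comp (Node S ts)) =
      cmp ?ns (sym_comp S) (map (\<lambda>t. planar (map_ptree sym_comp t)) ts)"
    by (simp add: leaves_map_ptree comp_def)
  also have "map (\<lambda>t. planar (map_ptree sym_comp t)) ts = map (\<lambda>j. act (?ns ! j) (?\<nu>s ! j) (\<rho>s j)) [0..<length ?ns]"
    by (rule nth_equalityI) (use \<rho>s in auto)
  also have "cmp ?ns (sym_comp S) \<dots> = act (sum_list ?ns) (act (sum_list ?ns) (planar (subst_tree (Node S ts))) \<beta>2) \<beta>1"
    by (simp only: \<beta>1(3)) (simp only: \<gamma>S \<beta>2(3) sub_eq)
  also have "\<dots> = act (sum_list ?ns) (planar (subst_tree (Node S ts))) (\<beta>2 \<circ> \<beta>1)"
    using pos sub_closed \<beta>2(1) \<beta>1(1) by (rule act_comp[symmetric])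
  finally have "planar (map_ptree sym_comp (Node S ts)) =
    act (sum_list ?ns) (planar (subst_tree (Node S ts))) (\<beta>2 \<circ> \<beta>1)" .
  moreover have "\<beta>2 \<circ> \<beta>1 permutes {..<sum_list ?ns}"
    using \<beta>1(1) \<beta>2(1) by (rule permutes_compose)
  moreover have "leaves (subst_tree (Node S ts)) ! (\<beta>2 \<circ> \<beta>1) p = leaves (Node S ts) ! p"
    if p_less: "p < sum_list ?ns" for p
  proof -
    obtain j b where j: "j < length ?ns" and b: "b < ?ns ! j" and p: "p = offset ?ns j + b"
      using offset_surj[OF p_less] by blast
    \<comment> \<open>The place of label \<open>j\<close> in the leaf word of \<open>S\<close>. Thus
      \<open>\<beta>1\<close> moves \<open>b\<close> inside block \<open>j\<close>, and
      \<open>\<beta>2\<close> carries the block to where child \<open>j\<close> is grafted.\<close>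
    let ?i = "inv_into UNIV ?\<alpha> j"
    have \<rho>: "\<rho>s j b < ?ns ! j"
      using permutes_in_image[of "\<rho>s j" _ b] \<rho>s[of j] j b by auto
    have i: "?i < length ts" "leaves S ! ?i = j"
      using permutes_in_image[OF permutes_inv[OF \<alpha>], of j] permutes_inverses(1)[OF \<alpha>, of j] j len_S
      by (auto split: if_splits)
    let ?xss = "map (\<lambda>l. leaves (?us ! l)) (leaves S)"
    have "(\<beta>2 \<circ> \<beta>1) p = offset (permute_list ?\<alpha> ?ns) ?i + \<rho>s j b"
      using \<beta>1(2)[rule_format, OF j b] \<beta>2(2)[rule_format, OF j \<rho>] by (simp only: p comp_apply)
    also have "permute_list ?\<alpha> ?ns = map length ?xss"
      unfolding ms by simp
    finally have "leaves (subst_tree (Node S ts)) ! (\<beta>2 \<circ> \<beta>1) p = concat ?xss ! (offset (map length ?xss) ?i + \<rho>s j b)"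
      by (simp only: subst_tree.simps leaves_graft)
    also have "\<dots> = ?xss ! ?i ! \<rho>s j b"
      by (rule concat_nth_offset) (use i j \<rho> len_S len in auto)
    also have "\<dots> = leaves (ts ! j) ! b"
      using i j b len_S \<rho>s[of j] by simp
    also have "\<dots> = concat (map leaves ts) ! (offset (map length (map leaves ts)) j + b)"
      using j b by (subst concat_nth_offset) auto
    finally show ?thesis by (simp add: p comp_def)
  qed
  ultimately show ?case unfolding sum_ns by blast
qed

text \<open>Here the labels do form a permutation, so matching leaf words means
  \<open>?m \<circ> \<rho> = ?l\<close>. Hence the inverse of \<open>?m\<close> is
  \<open>\<rho>\<close> after the inverse of \<open>?l\<close>, and \<open>act_comp\<close> absorbs
  \<open>\<rho>\<close> into the composite with composed decorations.\<close>

lemma sym_comp_subst_tree: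
  assumes sub: "substitutable T" and T: "distinct (leaves T)" "set (leaves T) = {..<length (leaves T)}"
  shows "sym_comp (subst_tree T) = sym_comp (map_ptree sym_comp T)"
proof -
  let ?N = "length (leaves T)" and ?l = "list_perm (leaves T)" and ?m = "list_perm (leaves (subst_tree T))"
  note len = length_leaves_subst_tree[OF sub]
  obtain \<rho> where \<rho>: "\<rho> permutes {..<?N}"
    "\<forall>p < ?N. leaves (subst_tree T) ! \<rho> p = leaves T ! p"
    "planar (map_ptree sym_comp T) = act ?N (planar (subst_tree T)) \<rho>"
    using planar_map_sym_comp[OF sub] by blast
  have l: "?l permutes {..<?N}" using T by (rule list_perm_permutes)
  have "?m \<circ> \<rho> = ?l"
  proof
    fix p
    show "(?m \<circ> \<rho>) p = ?l p"
      using \<rho>(2) permutes_in_image[OF \<rho>(1), of p] permutes_not_in[OF \<rho>(1), of p] by (auto simp: len)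
  qed
  then have "?l \<circ> inv_into UNIV \<rho> = ?m \<circ> (\<rho> \<circ> inv_into UNIV \<rho>)"
    by (simp only: o_assoc)
  also have "\<dots> = ?m"
    by (simp only: permutes_inv_o(1)[OF \<rho>(1)] comp_id)
  finally have "?m = ?l \<circ> inv_into UNIV \<rho>" ..
  then have "inv_into UNIV ?m = \<rho> \<circ> inv_into UNIV ?l"
    using permutes_inv_inv[OF \<rho>(1)] permutes_bij[OF l] permutes_bij[OF permutes_inv[OF \<rho>(1)]]
    by (simp add: o_inv_distrib)
  then have "sym_comp (subst_tree T) = act ?N (planar (subst_tree T)) (\<rho> \<circ> inv_into UNIV ?l)"
    by (simp only: shuffle_of_symmetric_def len)
  also have "\<dots> = act ?N (act ?N (planar (subst_tree T)) \<rho>) (inv_into UNIV ?l)"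
    using composable_planar[OF composable_subst_tree[OF sub]] \<rho>(1) permutes_inv[OF l]
    by (intro act_comp) (simp_all add: len)
  also have "\<dots> = sym_comp (map_ptree sym_comp T)"
    by (simp only: shuffle_of_symmetric_def leaves_map_ptree \<rho>(3))
  finally show ?thesis .
qed

section \<open>Multilinearity of planar composition in the decorations\<close>

lemma planar_decorate_list_update:
  assumes ml: "\<forall>t \<in> set ts. multilinear K (map (\<lambda>v. P (arity v)) (vertices t)) (P (length (leaves t)))
      (\<lambda>xs. planar (decorate t xs))"
    and xs: "xs \<in> listset (map carrier (map (\<lambda>v. P (arity v)) (concat (map vertices ts))))"
    and i: "i < length xs"
  shows "\<exists>j < length ts. \<exists>h. linear_map K (P (arity (concat (map vertices ts) ! i))) (P (length (leaves (ts ! j)))) h \<and>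
    (\<forall>z. map planar (decorate_list ts (xs[i := z])) = (map planar (decorate_list ts xs))[j := h z])"
  using assms
proof (induction ts arbitrary: xs i)
  case (Cons t ts)
  let ?m = "length (vertices t)" and ?N = "\<lambda>t. P (length (leaves t))" and ?h = "\<lambda>xs. planar (decorate t xs)"
  have split: "take ?m xs \<in> listset (map carrier (map (\<lambda>v. P (arity v)) (vertices t)))"
    "drop ?m xs \<in> listset (map carrier (map (\<lambda>v. P (arity v)) (concat (map vertices ts))))"
    using Cons.prems(2) by (simp_all add: listset_append)
  have t: "multilinear K (map (\<lambda>v. P (arity v)) (vertices t)) (?N t) ?h"
    using Cons.prems(1) by simp
  show ?case
  \<comment> \<open>The first \<open>?m\<close> decorations belong to the first child; changing one
    of them leaves the other children alone, and conversely.\<close>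
  proof (cases "i < ?m")
    case True
    with t split(1) have "linear_map K (P (arity (vertices t ! i))) (?N t) (\<lambda>z. ?h ((take ?m xs)[i := z]))"
      by (simp add: multilinear_iff)
    with True show ?thesis
      by (intro exI[of _ 0] exI[of _ "\<lambda>z. ?h ((take ?m xs)[i := z])"] conjI)
        (simp_all add: nth_append take_update_swap)
  next
    case False
    have "i - ?m < length (drop ?m xs)" using False Cons.prems(3) by auto
    then obtain j h where "j < length ts"
      "linear_map K (P (arity (concat (map vertices ts) ! (i - ?m)))) (?N (ts ! j)) h"
      "\<And>z. map planar (decorate_list ts ((drop ?m xs)[i - ?m := z])) = (map planar (decorate_list ts (drop ?m xs)))[j := h z]"
      using Cons.IH[OF _ split(2), of "i - ?m"] Cons.prems(1) by auto
    with False show ?thesis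
      by (intro exI[of _ "Suc j"] exI[of _ h] conjI) (simp_all add: nth_append drop_update_swap)
  qed
qed simp

lemma planar_decorate_list_listset:
  assumes "\<forall>t \<in> set ts. multilinear K (map (\<lambda>v. P (arity v)) (vertices t)) (P (length (leaves t)))
      (\<lambda>xs. planar (decorate t xs))"
    and "xs \<in> listset (map carrier (map (\<lambda>v. P (arity v)) (concat (map vertices ts))))"
  shows "map planar (decorate_list ts xs) \<in> listset (map carrier (map (\<lambda>t. P (length (leaves t))) ts))"
  using assms
proof (induction ts arbitrary: xs)
  case (Cons t ts)
  let ?m = "length (vertices t)"
  have split: "take ?m xs \<in> listset (map carrier (map (\<lambda>v. P (arity v)) (vertices t)))"
    "drop ?m xs \<in> listset (map carrier (map (\<lambda>v. P (arity v)) (concat (map vertices ts))))"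
    using Cons.prems(2) by (simp_all add: listset_append)
  have "map planar (decorate_list ts (drop ?m xs)) \<in> listset (map carrier (map (\<lambda>t. P (length (leaves t))) ts))"
    using Cons.IH[OF _ split(2)] Cons.prems(1) by simp
  moreover have "planar (decorate t (take ?m xs)) \<in> carrier (P (length (leaves t)))"
    using split(1) Cons.prems(1) unfolding multilinear_iff by simp
  ultimately show ?case by (simp add: set_Cons_def)
qed simp

text \<open>The last decoration is the root operation and enters \<open>cmp\<close> directly. Any
  other enters linearly through exactly one child, so linearity in it is a composite of two linear
  maps.\<close>

lemma planar_decorate_multilinear:
  assumes "\<forall>v \<in> set (vertices T). inputs v \<noteq> []"
  shows "multilinear K (map (\<lambda>v. P (arity v)) (vertices T)) (P (length (leaves T)))
    (\<lambda>xs. planar (decorate T xs))"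
  using assms
proof (induction T)
  case (Leaf l)
  show ?case using id_carrier by (simp add: multilinear_iff)
next
  case (Node v ts)
  let ?ns = "map (\<lambda>t. length (leaves t)) ts" and ?vs = "concat (map vertices ts)"
  let ?Ms = "P (length ?ns) # map P ?ns"
  let ?F = "\<lambda>xs. cmp ?ns (hd xs) (tl xs)"
  have ml: "\<forall>t \<in> set ts. multilinear K (map (\<lambda>v. P (arity v)) (vertices t)) (P (length (leaves t)))
      (\<lambda>xs. planar (decorate t xs))"
    using Node by auto
  \<comment> \<open>\<open>composable_planar\<close> does not apply here, because the decorations of
    \<open>T\<close> are not operations.\<close>
  have "length (leaves t) \<ge> 1" if "\<forall>v \<in> set (vertices t). inputs v \<noteq> []" for t :: "'b ptree"
    using that
  proof (induction t)
    case (Node v ts)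
    then obtain t ts' where "ts = t # ts'" by (cases ts) auto
    with Node show ?case by fastforce
  qed simp
  then have "\<forall>i \<in> set ?ns. i \<ge> 1" using Node.prems by auto
  moreover have "?ns \<noteq> []" using Node.prems by simp
  ultimately have F: "multilinear K ?Ms (P (sum_list ?ns)) ?F"
    by (intro comp_multilinear)
  have planar_Node: "planar (decorate (Node v ts) xs) = ?F (last xs # map planar (decorate_list ts (butlast xs)))" for xs
  proof -
    have "map (\<lambda>t. length (leaves t)) (decorate_list ts (butlast xs)) = map length (map leaves (decorate_list ts (butlast xs)))"
      by simp
    also have "\<dots> = ?ns" unfolding leaves_decorate_list by simp
    finally show ?thesis by simp
  qed
  have sum: "sum_list ?ns = length (leaves (Node v ts))" by (simp add: length_concat comp_def)
  show ?case
    unfolding multilinear_iff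
  proof (intro ballI conjI allI impI)
    fix xs assume xs: "xs \<in> listset (map carrier (map (\<lambda>v. P (arity v)) (vertices (Node v ts))))"
    then have len_xs: "length xs = Suc (length ?vs)"
      by (drule_tac listset_length) (simp del: length_concat)
    then obtain ys \<mu> where ys: "xs = ys @ [\<mu>]" by (cases xs rule: rev_cases) auto
    have len: "length ys = length ?vs"
      using len_xs by (simp add: ys del: length_concat)
    have "ys \<in> listset (map carrier (map (\<lambda>v. P (arity v)) ?vs))" and \<mu>: "\<mu> \<in> carrier (P (length ?ns))"
      using xs by (simp_all add: ys in_listset_iff list_all2_append len del: length_concat)
    let ?zs = "map planar (decorate_list ts ys)"
    have zs: "\<mu> # ?zs \<in> listset (map carrier ?Ms)"
      using planar_decorate_list_listset[OF ml \<open>ys \<in> _\<close>] \<mu> by (simp add: set_Cons_def comp_def)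
    note F' = bspec[OF F[unfolded multilinear_iff] zs]
    from F' have "?F (\<mu> # ?zs) \<in> carrier (P (sum_list ?ns))" by (rule conjunct1)
    then show "planar (decorate (Node v ts) xs) \<in> carrier (P (length (leaves (Node v ts))))"
      unfolding planar_Node sum by (simp add: ys)
    fix i assume "i < length (map (\<lambda>v. P (arity v)) (vertices (Node v ts)))"
    then consider "i = length ys" | "i < length ys" by (auto simp: len less_Suc_eq simp del: length_concat)
    then show "linear_map K (map (\<lambda>v. P (arity v)) (vertices (Node v ts)) ! i) (P (length (leaves (Node v ts))))
      (\<lambda>z. planar (decorate (Node v ts) (xs[i := z])))"
    proof cases
      case 1
      have "linear_map K (?Ms ! 0) (P (sum_list ?ns)) (\<lambda>z. ?F ((\<mu> # ?zs)[0 := z]))"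
        using F' by blast
      then show ?thesis
        unfolding planar_Node sum
        by (simp add: ys 1) (simp add: len nth_append del: length_concat)
    next
      case 2
      obtain j h where j: "j < length ts" and h: "linear_map K (P (arity (?vs ! i))) (P (length (leaves (ts ! j)))) h"
        and zs_h: "\<And>z. map planar (decorate_list ts (ys[i := z])) = ?zs[j := h z]"
        using planar_decorate_list_update[OF ml \<open>ys \<in> _\<close> 2] by blast
      \<comment> \<open>The shift to \<open>Suc j\<close> comes from the root operation, which
        occupies slot 0.\<close>
      have "linear_map K (?Ms ! Suc j) (P (sum_list ?ns)) (\<lambda>z. ?F ((\<mu> # ?zs)[Suc j := z]))"
        using spec[OF conjunct2[OF F'], of "Suc j"] j by simp
      then have "linear_map K (P (length (leaves (ts ! j)))) (P (sum_list ?ns)) (\<lambda>z. ?F (\<mu> # ?zs[j := z]))"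
        using j by simp
      from linear_map_comp[OF h this] show ?thesis
        unfolding planar_Node sum using 2 by (simp add: ys len nth_append list_update_append zs_h del: length_concat)
    qed
  qed
qed

theorem shuffle_operad_of_symmetric: "shuffle_operad K P e sym_comp"
proof (intro shuffle_operad.intro shuffle_operad_axioms.intro)
  show "arity_graded_module K P e" by (rule arity_graded_module_axioms)
next
  fix n and \<tau> :: "unit ptree" assume sh: "shuffle_tree n \<tau>"
  then have leaves: "distinct (leaves \<tau>)" "set (leaves \<tau>) = {..<n + 1}"
    by (auto simp: shuffle_tree_def)
  then have len: "length (leaves \<tau>) = n + 1" by (metis card_lessThan distinct_card)
  have perm: "list_perm (leaves \<tau>) permutes {..<n + 1}"
    using list_perm_permutes[of "leaves \<tau>"] leaves len by simp
  have "\<forall>v \<in> set (vertices \<tau>). inputs v \<noteq> []"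
    using sh by (force simp: shuffle_tree_def)
  then have "multilinear K (map (\<lambda>v. P (arity v)) (vertices \<tau>)) (P (n + 1)) (\<lambda>xs. planar (decorate \<tau> xs))"
    using planar_decorate_multilinear[of \<tau>] len by simp
  \<comment> \<open>The leaf word does not depend on the decorations, so one fixed linear map
    follows the planar composite.\<close>
  from multilinear_linear_comp[OF this act_linear_map[OF _ permutes_inv[OF perm]]]
  show "multilinear K (map (\<lambda>v. P (arity v)) (vertices \<tau>)) (P (n + 1)) (\<lambda>xs. sym_comp (decorate \<tau> xs))"
    unfolding shuffle_of_symmetric_def leaves_decorate by (simp add: len)
next
  have lp: "list_perm (leaves (Leaf 0 :: 'a ptree)) = id" by (auto simp: fun_eq_iff)
  show "sym_comp (Leaf 0) = e"
    unfolding shuffle_of_symmetric_def lp using act_id[of 1 e] id_carrier by simp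
next
  fix n \<mu> assume "n \<ge> 1" and \<mu>: "\<mu> \<in> carrier (P (n + 1))"
  have lv: "leaves (corolla n \<mu>) = [0..<n + 1]"
    by (simp add: corolla_def comp_def)
  have lp: "list_perm (leaves (corolla n \<mu>)) = id" unfolding lv by (auto simp: fun_eq_iff)
  have "sym_comp (corolla n \<mu>) = act (n + 1) (planar (corolla n \<mu>)) id"
    unfolding shuffle_of_symmetric_def lp by (simp add: lv)
  also have "planar (corolla n \<mu>) = cmp (replicate (n + 1) 1) \<mu> (replicate (n + 1) e)"
    by (simp add: corolla_def comp_def map_replicate_const del: replicate_Suc)
  also have "\<dots> = \<mu>" using \<mu> by (intro comp_id_right) simp_all
  also have "act (n + 1) \<mu> id = \<mu>" using \<mu> by (intro act_id) simp_all
  finally show "sym_comp (corolla n \<mu>) = \<mu>" .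
next
  fix n and T :: "'a ptree ptree"
  assume T: "shuffle_tree n T"
    and *: "\<forall>v \<in> set (vertices T). shuffle_tree (arity v - 1) (decoration v) \<and>
        (\<forall>w \<in> set (vertices (decoration v)). decoration w \<in> carrier (P (arity w)))"
  have leaves: "distinct (leaves T)" "set (leaves T) = {..<length (leaves T)}"
  proof -
    show d: "distinct (leaves T)" using T by (simp add: shuffle_tree_def)
    have "set (leaves T) = {..<n + 1}" using T by (auto simp: shuffle_tree_def)
    with d show "set (leaves T) = {..<length (leaves T)}" by (metis card_lessThan distinct_card)
  qed
  have "substitutable T"
    unfolding substitutable_def
  proof (intro ballI conjI)
    fix v assume v: "v \<in> set (vertices T)"
    with T have ar: "arity v \<ge> 2" by (simp add: shuffle_tree_def)
    then show "inputs v \<noteq> []" by auto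
    have sh: "shuffle_tree (arity v - 1) (decoration v)" using * v by blast
    then show "distinct (leaves (decoration v))" by (simp add: shuffle_tree_def)
    \<comment> \<open>The bound on the arity matters: with truncated subtraction,
      \<open>{0..arity v - 1}\<close> equals \<open>{..<arity v}\<close> only for positive
      arity.\<close>
    from sh ar show "set (leaves (decoration v)) = {..<arity v}"
      by (auto simp: shuffle_tree_def)
    from sh have "inputs w \<noteq> []" if "w \<in> set (vertices (decoration v))" for w
      using that by (force simp: shuffle_tree_def)
    with * v show "composable (decoration v)" by (simp add: composable_def)
  qed
  with leaves show "sym_comp (subst_tree T) = sym_comp (map_ptree sym_comp T)"
    by (intro sym_comp_subst_tree)
qed

end

theorem proposition7p3:
  shows
    "(\<forall>n k. bij_betw (sur_of_comb n) (shuffle_left_combs n k :: unit ptree set) (Sur n k)) \<and>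
     (\<forall>n k (\<tau> :: unit ptree) is ms (\<tau>s :: nat \<Rightarrow> unit ptree).
        \<tau> \<in> shuffle_left_combs n k \<longrightarrow>
        (\<forall>j \<in> {1..k}. arity (vertices \<tau> ! (j - 1)) = is j + 1 \<and>
           \<tau>s j \<in> shuffle_left_combs (is j) (ms j)) \<longrightarrow>
        subst_tree (decorate \<tau> (map \<tau>s [1..<k + 1])) \<in> shuffle_left_combs n (\<Sum>j = 1..k. ms j) \<and>
        sur_of_comb n (subst_tree (decorate \<tau> (map \<tau>s [1..<k + 1]))) =
          subst_sur n (sur_of_comb n \<tau>) ms (\<lambda>j. sur_of_comb (is j) (\<tau>s j))) \<and>
     (\<forall>(K :: 'k ring) (P :: nat \<Rightarrow> ('k, 'a) module) e \<gamma>.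
        shuffle_operad K P e \<gamma> \<longrightarrow> permutad K P e (restrict_to_combs \<gamma>)) \<and>
     (\<forall>(K :: 'k ring) (P :: nat \<Rightarrow> ('k, 'a) module) e act cmp.
        symmetric_operad K P e act cmp \<longrightarrow>
        permutad K P e (restrict_to_combs (shuffle_of_symmetric act cmp e)))"
proof (intro conjI allI impI)
  fix n k
  show "bij_betw (sur_of_comb n) (shuffle_left_combs n k :: unit ptree set) (Sur n k)"
    by (rule bij_betw_sur_of_comb)
next
  fix n k and \<tau> :: "unit ptree" and ns ms and \<tau>s :: "nat \<Rightarrow> unit ptree"
  assume "\<tau> \<in> shuffle_left_combs n k"
    and "\<forall>j \<in> {1..k}. arity (vertices \<tau> ! (j - 1)) = ns j + 1 \<and> \<tau>s j \<in> shuffle_left_combs (ns j) (ms j)"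
  then show "subst_tree (decorate \<tau> (map \<tau>s [1..<k + 1])) \<in> shuffle_left_combs n (\<Sum>j = 1..k. ms j)"
    and "sur_of_comb n (subst_tree (decorate \<tau> (map \<tau>s [1..<k + 1]))) =
      subst_sur n (sur_of_comb n \<tau>) ms (\<lambda>j. sur_of_comb (ns j) (\<tau>s j))"
    by (rule shuffle_left_combs_subst)+
next
  fix K :: "'k ring" and P :: "nat \<Rightarrow> ('k, 'a) module" and e \<gamma>
  assume "shuffle_operad K P e \<gamma>"
  then show "permutad K P e (restrict_to_combs \<gamma>)"
    by (rule shuffle_operad.permutad_restrict_to_combs)
next
  fix K :: "'k ring" and P :: "nat \<Rightarrow> ('k, 'a) module" and e act cmp
  assume "symmetric_operad K P e act cmp"
  then show "permutad K P e (restrict_to_combs (shuffle_of_symmetric act cmp e))"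
    by (intro shuffle_operad.permutad_restrict_to_combs symmetric_operad.shuffle_operad_of_symmetric)
qed

end
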